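(* Consider the independent-cluster model $Y_i=X_i\beta+Z_iU_i+E_i$, $i\in\{1,\dots,m\}$, with $n=\sum_{i=1}^mn_i=m\bar n$. Assume, for constants $c_1>1$ and $c_2\in(1,\infty)$, that (i) $\bar n/q_1\geq c_1$ and (ii) for every $i\in\{1,\dots,m\}$, \[ c_2^{-1}\leq\gamma_{\min}(Z_i^{\mathsf T}Z_i)\leq\gamma_{\max}(Z_i^{\mathsf T}Z_i)\leq c_2 . \] Then there is a constant $c_3<\infty$, not depending on any model parameters or quantities other than through $c_1,c_2$, such that for every $v\in\mathbb{S}^{r-1}$ and $\psi\in\mathbb{P}$, \[ a(v,\psi)\leq c_3m^{-1/2}(1+\|\psi_{-r}\|/\psi_r). \] Moreover, if in addition $X$ has full column rank $p<n$ and (iii) $p/m\leq c_4$ for a small enough constant $c_4>0$ (depending only on $c_1,c_2$), then the same bound holds with $\tilde a(v,\psi)$ in place of $a(v,\psi)$, with a different constant $c_3$ (of the same kind).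
   Context: Model: independently for $i\in\{1,\dots,m\}$, $Y_i=X_i\beta+Z_iU_i+E_i$, where $X_i\in\mathbb{R}^{n_i\times p}$ and $Z_i\in\mathbb{R}^{n_i\times q_1}$ are non-stochastic, $E_i\sim\mathrm{N}(0,\psi_rI_{n_i})$ and $U_i\sim\mathrm{N}(0,\Psi_1)$ are independent, $\Psi_1\in\mathbb{R}^{q_1\times q_1}$. Stack $Y=[Y_1^{\mathsf T},\dots,Y_m^{\mathsf T}]^{\mathsf T}$, $X=[X_1^{\mathsf T},\dots,X_m^{\mathsf T}]^{\mathsf T}\in\mathbb{R}^{n\times p}$, and let $Z$ be block-diagonal with diagonal blocks $Z_1,\dots,Z_m$, so $Z\in\mathbb{R}^{n\times q}$, $q=mq_1$. Let $\psi=[\psi_1,\dots,\psi_r]^{\mathsf T}$ with $r=q_1(q_1+1)/2+1$, $\psi_{-r}=[\psi_1,\dots,\psi_{r-1}]^{\mathsf T}=\mathrm{vech}(\Psi_1)$ (half-vectorization, stacking the lower triangular part). For any $v\in\mathbb{R}^r$, $\Psi_1(v)$ is the symmetric $q_1\times q_1$ matrix whose half-vectorization is $v_{-r}=[v_1,\dots,v_{r-1}]^{\mathsf T}$, $\Psi(v)=I_m\otimes\Psi_1(v)$, and $\Sigma(v)=Z\Psi(v)Z^{\mathsf T}+v_rI_n$; thus $Y\sim\mathrm{N}(X\beta,\Sigma(\psi))$. Let $H_j=\partial\Psi/\partial\psi_j$. The parameter set is $\mathbb{P}=\{\psi\in\mathbb{R}^r:\Psi_1(\psi)\geq0,\ \psi_r>0\}$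 ($\geq0$: positive semi-definite). Notation: $\gamma_{\min},\gamma_{\max}$ are the smallest and largest eigenvalues; $\|\cdot\|$ is the Euclidean norm of vectors and spectral norm of matrices; $\|\cdot\|_F$ is the Frobenius norm; $\mathbb{S}^{r-1}$ is the unit sphere in $\mathbb{R}^r$. For $v\in\mathbb{R}^r,\psi\in\mathbb{P}$: $A(v,\psi)=\Sigma(\psi)^{-1/2}\Sigma(v)\Sigma(\psi)^{-1/2}$, and $a(v,\psi)=\|A(v,\psi)\|/\|A(v,\psi)\|_F$ if $\|A(v,\psi)\|_F>0$, $a(v,\psi)=1$ otherwise. Restricted-likelihood version: when $X$ has full column rank $p<n$, let $V\in\mathbb{R}^{n\times(n-p)}$ be semi-orthogonal ($V^{\mathsf T}V=I_{n-p}$) with $V^{\mathsf T}X=0$, $\tilde Z=V^{\mathsf T}Z$, $\tilde\Sigma(\psi)=V^{\mathsf T}\Sigma(\psi)V=\tilde Z\Psi(\psi)\tilde Z^{\mathsf T}+\psi_rI_{n-p}$, $\tilde A_j=\tilde\Sigma^{-1/2}\tilde ZH_j\tilde Z^{\mathsf T}\tilde\Sigma^{-1/2}$ for $j<r$, $\tilde A_r=\tilde\Sigma^{-1}$, $\tilde A(v,\psi)=\sum_{j=1}^rv_j\tilde A_j(\psi)$, and $\tilde a(v,\psi)=\|\tilde A(v,\psi)\|/\|\tilde A(v,\psi)\|_F$ if $\|\tilde A(v,\psi)\|_F>0$, $\tilde a(v,\psi)=1$ otherwise. *)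

theory Defs
  imports
    "HOL-Analysis.Derivative"
    "HOL-Analysis.L2_Norm"
    "Jordan_Normal_Form.Gauss_Jordan_Elimination"
    "Jordan_Normal_Form.DL_Rank"
    "Jordan_Normal_Form.Spectral_Radius"
begin

unbundle no vec_syntax
unbundle no inner_syntax

section \<open>Norms, extreme eigenvalues and roots of real matrices\<close>

definition vnorm :: "real vec \<Rightarrow> real" where
  "vnorm x = L2_set (\<lambda>i. x $ i) {..<dim_vec x}"

definition spectral_norm :: "real mat \<Rightarrow> real" where
  "spectral_norm A = (SUP x\<in>{x \<in> carrier_vec (dim_col A). vnorm x \<le> 1}. vnorm (A *\<^sub>v x))"

definition frobenius_norm :: "real mat \<Rightarrow> real" where
  "frobenius_norm A = L2_set (\<lambda>ij. A $$ ij) ({..<dim_row A} \<times> {..<dim_col A})"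

text \<open>Both are used for symmetric matrices of positive dimension only; there the spectrum is finite
  and nonempty.\<close>

definition eig_min :: "real mat \<Rightarrow> real" where
  "eig_min A = Min (spectrum A)"

definition eig_max :: "real mat \<Rightarrow> real" where
  "eig_max A = Max (spectrum A)"

definition symmetric :: "real mat \<Rightarrow> bool" where
  "symmetric A \<longleftrightarrow> square_mat A \<and> A\<^sup>T = A"

definition psd :: "real mat \<Rightarrow> bool" where
  "psd A \<longleftrightarrow> symmetric A \<and> (\<forall>x\<in>carrier_vec (dim_col A). 0 \<le> x \<bullet> (A *\<^sub>v x))"

definition psd_sqrt :: "real mat \<Rightarrow> real mat" where
  "psd_sqrt A = (THE B. psd B \<and> B * B = A)"

text \<open>The inverse is unspecified when \<open>A\<close> is singular; it is only used for positive definite \<open>A\<close>.\<close>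

definition inv_mat :: "real mat \<Rightarrow> real mat" where
  "inv_mat A = the (mat_inverse A)"

definition inv_sqrt :: "real mat \<Rightarrow> real mat" where
  "inv_sqrt A = inv_mat (psd_sqrt A)"

definition kronecker :: "real mat \<Rightarrow> real mat \<Rightarrow> real mat" where
  "kronecker A B = mat (dim_row A * dim_row B) (dim_col A * dim_col B)
     (\<lambda>(i, j). A $$ (i div dim_row B, j div dim_col B) * B $$ (i mod dim_row B, j mod dim_col B))"

definition norm_ratio :: "real mat \<Rightarrow> real" where
  "norm_ratio A =
     (if frobenius_norm A > 0 then spectral_norm A / frobenius_norm A else 1)"


section \<open>Half-vectorization\<close>

text \<open>The index pairs of the lower triangle, column by column.\<close>

definition vech_pairs :: "nat \<Rightarrow> (nat \<times> nat) list" where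
  "vech_pairs q = concat (map (\<lambda>j. map (\<lambda>i. (i, j)) [j..<q]) [0..<q])"

definition vech :: "real mat \<Rightarrow> real vec" where
  "vech A = vec_of_list (map (\<lambda>ij. A $$ ij) (vech_pairs (dim_row A)))"

lemma set_vech_pairs: "set (vech_pairs q) = {(i, j). j \<le> i \<and> i < q}"
  by (force simp: vech_pairs_def)

lemma distinct_vech_pairs: "distinct (vech_pairs q)"
proof -
  have "distinct (concat (map (\<lambda>j. map (\<lambda>i. (i, j)) [j..<q]) js))" if "distinct js" for js
    using that by (induction js) (auto simp: distinct_map inj_on_def)
  then show ?thesis by (simp add: vech_pairs_def)
qed

lemma length_vech_pairs: "length (vech_pairs q) = q * (q + 1) div 2"
proof -
  have "length (vech_pairs q) = (\<Sum>j<q. q - j)"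
    by (simp add: vech_pairs_def length_concat comp_def interv_sum_list_conv_sum_set_nat
        atLeast0LessThan)
  also have "\<dots> = (\<Sum>j<q. Suc j)"
    by (subst sum.nat_diff_reindex[of Suc q, symmetric]) (auto intro!: sum.cong)
  also have "\<dots> = q * (q + 1) div 2"
    by (induction q) auto
  finally show ?thesis .
qed

text \<open>The number of parameters: the entries of \<open>vech \<Psi>\<^sub>1\<close> and one error variance. Coordinates
  are numbered from 0, so the error variance has index \<open>nparams q1 - 1\<close>.\<close>

definition nparams :: "nat \<Rightarrow> nat" where
  "nparams q1 = q1 * (q1 + 1) div 2 + 1"

definition cov_part :: "nat \<Rightarrow> real vec \<Rightarrow> real vec" where
  "cov_part q1 v = vec_first v (nparams q1 - 1)"

definition err_part :: "nat \<Rightarrow> real vec \<Rightarrow> real" where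
  "err_part q1 v = v $ (nparams q1 - 1)"

definition Psi1 :: "nat \<Rightarrow> real vec \<Rightarrow> real mat" where
  "Psi1 q1 v = (THE B. B \<in> carrier_mat q1 q1 \<and> symmetric B \<and> vech B = cov_part q1 v)"

lemma ex1_Psi1: "\<exists>!B. B \<in> carrier_mat q q \<and> symmetric B \<and> vech B = cov_part q v"
proof -
  define ps where "ps = vech_pairs q"
  define pos where "pos = (\<lambda>ij. THE k. k < length ps \<and> ps ! k = ij)"
  have pos: "pos (ps ! k) = k" if "k < length ps" for k
    unfolding pos_def using that distinct_vech_pairs[of q]
    by (intro the_equality) (auto simp: ps_def nth_eq_iff_index_eq)
  have low: "j \<le> i \<and> i < q" if "k < length ps" "ps ! k = (i, j)" for k i j
    using that nth_mem[of k ps] set_vech_pairs[of q] by (auto simp: ps_def)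
  have len: "length ps = nparams q - 1"
    by (simp add: ps_def length_vech_pairs nparams_def)
  define B where "B = mat q q (\<lambda>(i, j). v $ pos (max i j, min i j))"
  have B: "B \<in> carrier_mat q q" by (simp add: B_def)
  have sym: "symmetric B"
    unfolding symmetric_def B_def
    by (auto simp: max.commute min.commute intro!: eq_matI)
  have "vech B = cov_part q v"
  proof (rule eq_vecI)
    show "dim_vec (vech B) = dim_vec (cov_part q v)"
      using B len by (simp add: vech_def cov_part_def vec_first_def ps_def)
  next
    fix k assume "k < dim_vec (cov_part q v)"
    then have k: "k < length ps" by (simp add: cov_part_def vec_first_def len)
    obtain i j where ij: "ps ! k = (i, j)" by fastforce
    note lo = low[OF k ij]
    have "vech B $ k = B $$ (i, j)"
      using B k ij by (simp add: vech_def ps_def vec_of_list_index)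
    also have "\<dots> = v $ pos (i, j)" using lo by (simp add: B_def max_absorb1 min_absorb2)
    also have "\<dots> = v $ k" using pos[OF k] ij by simp
    finally show "vech B $ k = cov_part q v $ k"
      using k by (simp add: cov_part_def vec_first_def len)
  qed
  moreover have "C = D"
    if C: "C \<in> carrier_mat q q" "symmetric C" and D: "D \<in> carrier_mat q q" "symmetric D"
      and eq: "vech C = vech D" for C D
  proof -
    have "map (\<lambda>ij. C $$ ij) (vech_pairs q) = map (\<lambda>ij. D $$ ij) (vech_pairs q)"
      using arg_cong[OF eq, of list_of_vec] C(1) D(1)
      unfolding vech_def list_vec by simp
    then have low: "C $$ (i, j) = D $$ (i, j)" if "j \<le> i" "i < q" for i j
      using that set_vech_pairs[of q] by auto
    have sym: "M $$ (i, j) = M $$ (j, i)"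
      if "M \<in> carrier_mat q q" "symmetric M" "i < q" "j < q" for M i j
      using that index_transpose_mat(1)[of j M i] by (auto simp: symmetric_def)
    have "C $$ (i, j) = D $$ (i, j)" if "i < q" "j < q" for i j
    proof (cases "j \<le> i")
      case True
      then show ?thesis using low that by simp
    next
      case False
      then have "C $$ (j, i) = D $$ (j, i)" using low that by simp
      then show ?thesis using sym[OF C that] sym[OF D that] by simp
    qed
    then show ?thesis using C D by (intro eq_matI) auto
  qed
  ultimately show ?thesis using B sym by metis
qed


section \<open>Covariance matrices of the model\<close>

definition Psi :: "nat \<Rightarrow> nat \<Rightarrow> real vec \<Rightarrow> real mat" where
  "Psi m q1 v = kronecker (1\<^sub>m m) (Psi1 q1 v)"

text \<open>Here and below \<open>Z\<close> is the full \<open>n \<times> (m * q1)\<close> random effects design matrix.\<close>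

definition Sigma_cov :: "nat \<Rightarrow> nat \<Rightarrow> real mat \<Rightarrow> real vec \<Rightarrow> real mat" where
  "Sigma_cov m q1 Z v =
     Z * Psi m q1 v * Z\<^sup>T + err_part q1 v \<cdot>\<^sub>m 1\<^sub>m (dim_row Z)"

definition param_set :: "nat \<Rightarrow> real vec set" where
  "param_set q1 = {\<psi> \<in> carrier_vec (nparams q1). psd (Psi1 q1 \<psi>) \<and> err_part q1 \<psi> > 0}"

definition unit_sphere :: "nat \<Rightarrow> real vec set" where
  "unit_sphere r = {v \<in> carrier_vec r. vnorm v = 1}"

definition A_mat :: "nat \<Rightarrow> nat \<Rightarrow> real mat \<Rightarrow> real vec \<Rightarrow> real vec \<Rightarrow> real mat" where
  "A_mat m q1 Z v \<psi> =
     inv_sqrt (Sigma_cov m q1 Z \<psi>) * Sigma_cov m q1 Z v * inv_sqrt (Sigma_cov m q1 Z \<psi>)"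

definition a_ratio :: "nat \<Rightarrow> nat \<Rightarrow> real mat \<Rightarrow> real vec \<Rightarrow> real vec \<Rightarrow> real" where
  "a_ratio m q1 Z v \<psi> = norm_ratio (A_mat m q1 Z v \<psi>)"


section \<open>Restricted likelihood\<close>

text \<open>The partial derivative of \<open>\<Psi>\<close> at \<open>\<psi>\<close> in coordinate \<open>j\<close>, taken entrywise.\<close>

definition H_mat :: "nat \<Rightarrow> nat \<Rightarrow> real vec \<Rightarrow> nat \<Rightarrow> real mat" where
  "H_mat m q1 \<psi> j = mat (m * q1) (m * q1)
     (\<lambda>kl. deriv (\<lambda>t. Psi m q1 (\<psi> + t \<cdot>\<^sub>v unit_vec (nparams q1) j) $$ kl) 0)"

definition Sigma_tilde :: "nat \<Rightarrow> nat \<Rightarrow> real mat \<Rightarrow> real mat \<Rightarrow> real vec \<Rightarrow> real mat" where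
  "Sigma_tilde m q1 Z V \<psi> = V\<^sup>T * Sigma_cov m q1 Z \<psi> * V"

definition A_tilde_coord ::
  "nat \<Rightarrow> nat \<Rightarrow> real mat \<Rightarrow> real mat \<Rightarrow> real vec \<Rightarrow> nat \<Rightarrow> real mat" where
  "A_tilde_coord m q1 Z V \<psi> j =
     (let S = Sigma_tilde m q1 Z V \<psi>; Zt = V\<^sup>T * Z in
      if j < nparams q1 - 1
      then inv_sqrt S * Zt * H_mat m q1 \<psi> j * Zt\<^sup>T * inv_sqrt S
      else inv_mat S)"

definition A_tilde ::
  "nat \<Rightarrow> nat \<Rightarrow> real mat \<Rightarrow> real mat \<Rightarrow> real vec \<Rightarrow> real vec \<Rightarrow> real mat" where
  "A_tilde m q1 Z V v \<psi> = mat (dim_col V) (dim_col V)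
     (\<lambda>kl. \<Sum>j<nparams q1. v $ j * A_tilde_coord m q1 Z V \<psi> j $$ kl)"

definition a_tilde_ratio ::
  "nat \<Rightarrow> nat \<Rightarrow> real mat \<Rightarrow> real mat \<Rightarrow> real vec \<Rightarrow> real vec \<Rightarrow> real" where
  "a_tilde_ratio m q1 Z V v \<psi> = norm_ratio (A_tilde m q1 Z V v \<psi>)"


section \<open>Independent clusters\<close>

definition stack_rows :: "nat \<Rightarrow> nat \<Rightarrow> (nat \<Rightarrow> real mat) \<Rightarrow> real mat" where
  "stack_rows p m X = mat_of_rows p (concat (map (\<lambda>i. rows (X i)) [0..<m]))"

definition block_diag :: "nat \<Rightarrow> (nat \<Rightarrow> real mat) \<Rightarrow> real mat" where
  "block_diag m Z = diag_block_mat (map Z [0..<m])"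

text \<open>Clusters are numbered from 0. Cluster \<open>i\<close> has \<open>ns i\<close> observations and design matrices
  \<open>X i\<close>, \<open>Z i\<close>.\<close>

definition cluster_design ::
  "nat \<Rightarrow> (nat \<Rightarrow> nat) \<Rightarrow> nat \<Rightarrow> nat \<Rightarrow> (nat \<Rightarrow> real mat) \<Rightarrow> (nat \<Rightarrow> real mat) \<Rightarrow> bool" where
  "cluster_design m ns p q1 X Z \<longleftrightarrow> m \<ge> 1 \<and> q1 \<ge> 1 \<and>
     (\<forall>i<m. X i \<in> carrier_mat (ns i) p \<and> Z i \<in> carrier_mat (ns i) q1)"

definition total_obs :: "nat \<Rightarrow> (nat \<Rightarrow> nat) \<Rightarrow> nat" where
  "total_obs m ns = (\<Sum>i<m. ns i)"

definition mean_cluster_size :: "nat \<Rightarrow> (nat \<Rightarrow> nat) \<Rightarrow> real" where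
  "mean_cluster_size m ns = real (total_obs m ns) / real m"

definition regular_design ::
  "real \<Rightarrow> real \<Rightarrow> nat \<Rightarrow> (nat \<Rightarrow> nat) \<Rightarrow> nat \<Rightarrow> (nat \<Rightarrow> real mat) \<Rightarrow> bool" where
  "regular_design c1 c2 m ns q1 Z \<longleftrightarrow>
     mean_cluster_size m ns / real q1 \<ge> c1 \<and>
     (\<forall>i<m. 1 / c2 \<le> eig_min ((Z i)\<^sup>T * Z i) \<and>
            eig_min ((Z i)\<^sup>T * Z i) \<le> eig_max ((Z i)\<^sup>T * Z i) \<and>
            eig_max ((Z i)\<^sup>T * Z i) \<le> c2)"

definition full_column_rank :: "real mat \<Rightarrow> bool" where
  "full_column_rank X \<longleftrightarrow> vec_space.rank (dim_row X) X = dim_col X"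

text \<open>When \<open>X\<close> has full column rank, the columns of \<open>V\<close> are an orthonormal basis of the orthogonal
  complement of its column space.\<close>

definition complement_basis :: "real mat \<Rightarrow> real mat \<Rightarrow> bool" where
  "complement_basis X V \<longleftrightarrow>
     V \<in> carrier_mat (dim_row X) (dim_row X - dim_col X) \<and>
     V\<^sup>T * V = 1\<^sub>m (dim_row X - dim_col X) \<and>
     V\<^sup>T * X = 0\<^sub>m (dim_row X - dim_col X) (dim_col X)"

end

theory Submission
  imports Defs
begin

text \<open>
  Whitening a matrix by \<open>\<Sigma>(\<psi>)\<^bsup>-1/2\<^esup>\<close> divides its spectral norm by at least the smallest eigenvalue of
  \<open>\<Sigma>(\<psi>)\<close> and its Frobenius norm by at most the largest one. Hence the norm ratio of \<open>A(v,\<psi>)\<close> is at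
  most the condition number of \<open>\<Sigma>(\<psi>)\<close> times the norm ratio of \<open>\<Sigma>(v)\<close>
  (\<open>norm_ratio_whitened_le\<close>). The eigenvalues of \<open>\<Sigma>(\<psi>)\<close> are at least \<open>\<psi>\<^sub>r\<close> and at most \<open>\<psi>\<^sub>r\<close> plus
  \<open>c\<^sub>2\<close> times the Frobenius norm of \<open>\<Psi>\<^sub>1(\<psi>)\<close>, so the condition number accounts for the factor
  \<open>1 + \<parallel>\<psi>\<^bsub>-r\<^esub>\<parallel> / \<psi>\<^sub>r\<close> (\<open>Sigma_cov_condition\<close>). It remains to see that the norm ratio of
  \<open>\<Sigma>(v) = Z \<Psi>(v) Z\<^sup>T + v\<^sub>r I\<close> is of order \<open>m\<^bsup>-1/2\<^esup>\<close>, uniformly in \<open>v\<close> (\<open>Sigma_cov_flat\<close>).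

  The spectral norm of \<open>\<Sigma>(v)\<close> is at most \<open>\<bar>v\<^sub>r\<bar>\<close> plus \<open>c\<^sub>2\<close> times the Frobenius norm of
  \<open>\<Psi>\<^sub>1(v)\<close>, so both summands have to be bounded by \<open>m\<^bsup>-1/2\<^esup>\<close> times the Frobenius norm of \<open>\<Sigma>(v)\<close>. On
  the orthogonal complement of the column space of \<open>Z\<close>, whose dimension is at least
  \<open>(c\<^sub>1 - 1) m q\<^sub>1\<close>, the matrix \<open>\<Sigma>(v)\<close> acts as the scalar \<open>v\<^sub>r\<close>; this even bounds
  \<open>\<bar>v\<^sub>r\<bar> sqrt (m q\<^sub>1)\<close>. On the column space, whose dimension is \<open>m q\<^sub>1\<close>, the scalar part has Frobenius
  norm \<open>\<bar>v\<^sub>r\<bar> sqrt (m q\<^sub>1)\<close> and can therefore be subtracted. What is left is \<open>Z \<Psi>(v) Z\<^sup>T\<close>, and since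
  \<open>Z\<close> has a left inverse of bounded norm its Frobenius norm is at least a constant times that of
  \<open>\<Psi>(v)\<close>, which consists of \<open>m\<close> copies of \<open>\<Psi>\<^sub>1(v)\<close> (\<open>frobenius_sandwich_plus_scalar\<close>).

  The restricted version is the same argument for the compression \<open>V\<^sup>T \<Sigma>(v) V\<close> (\<open>A_tilde_eq\<close>). As
  \<open>I - V V\<^sup>T\<close> is a projection of rank \<open>p\<close>, compressing lowers the Frobenius norm by at most
  \<open>2 sqrt p\<close> times the spectral norm (\<open>frobenius_compression\<close>), which is a small fraction of it when
  \<open>p / m\<close> is small.

  Eigenvalue bounds and the square root of \<open>\<Sigma>(\<psi>)\<close> rest on the spectral theorem for real symmetric
  matrices (\<open>spectral_decomposition\<close>).\<close>

section \<open>Euclidean, operator and Frobenius norms\<close>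

lemma vnorm_sq: "(vnorm x)\<^sup>2 = x \<bullet> x"
  unfolding vnorm_def L2_set_def scalar_prod_def
  by (simp add: sum_nonneg power2_eq_square atLeast0LessThan)

lemma vnorm_nonneg [simp]: "0 \<le> vnorm x"
  by (simp add: vnorm_def)

lemma sprod_self_nonneg [simp]: "0 \<le> x \<bullet> (x :: real vec)"
  by (metis vnorm_sq zero_le_power2)

lemma vnorm_eq_sqrt: "vnorm x = sqrt (x \<bullet> x)"
  by (metis vnorm_sq real_sqrt_unique vnorm_nonneg)

lemma sprod_self_eq_0: "x \<in> carrier_vec n \<Longrightarrow> x \<bullet> x = (0::real) \<longleftrightarrow> x = 0\<^sub>v n"
  by (auto simp: scalar_prod_def sum_nonneg_eq_0_iff intro!: eq_vecI)

lemma abs_sprod_le: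
  assumes "x \<in> carrier_vec n" "y \<in> carrier_vec n"
  shows "\<bar>x \<bullet> y\<bar> \<le> vnorm x * vnorm y"
proof -
  have "\<bar>x \<bullet> y\<bar> \<le> (\<Sum>i<n. \<bar>x $ i\<bar> * \<bar>y $ i\<bar>)"
    using assms unfolding scalar_prod_def
    by (auto simp: atLeast0LessThan abs_mult intro: order_trans[OF sum_abs])
  also have "\<dots> \<le> vnorm x * vnorm y"
    using assms L2_set_mult_ineq[of "\<lambda>i. x $ i" "\<lambda>i. y $ i" "{..<n}"] by (simp add: vnorm_def)
  finally show ?thesis .
qed

lemma vnorm_add_le:
  assumes "x \<in> carrier_vec n" "y \<in> carrier_vec n"
  shows "vnorm (x + y) \<le> vnorm x + vnorm y"
proof -
  have "vnorm (x + y) = L2_set (\<lambda>i. x $ i + y $ i) {..<n}"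
    using assms unfolding vnorm_def by (auto intro!: L2_set_cong)
  then show ?thesis using assms L2_set_triangle_ineq[of "\<lambda>i. x $ i" "\<lambda>i. y $ i" "{..<n}"]
    by (simp add: vnorm_def)
qed

lemma vnorm_smult: "vnorm (c \<cdot>\<^sub>v x) = \<bar>c\<bar> * vnorm x"
proof -
  have "(c \<cdot>\<^sub>v x) \<bullet> (c \<cdot>\<^sub>v x) = c\<^sup>2 * (x \<bullet> x)"
    by (auto simp: scalar_prod_def sum_distrib_left power2_eq_square algebra_simps)
  then show ?thesis by (simp add: vnorm_eq_sqrt real_sqrt_mult)
qed

lemma frobenius_norm_nonneg [simp]: "0 \<le> frobenius_norm A"
  by (simp add: frobenius_norm_def)

lemma frobenius_norm_sq:
  assumes "A \<in> carrier_mat r c"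
  shows "(frobenius_norm A)\<^sup>2 = (\<Sum>i<r. \<Sum>j<c. (A $$ (i, j))\<^sup>2)"
  using assms unfolding frobenius_norm_def L2_set_def
  by (simp add: sum_nonneg sum.cartesian_product case_prod_unfold)

lemma frobenius_norm_sq_cols:
  assumes "A \<in> carrier_mat r c"
  shows "(frobenius_norm A)\<^sup>2 = (\<Sum>j<c. (vnorm (col A j))\<^sup>2)"
  unfolding frobenius_norm_sq[OF assms] vnorm_sq
  apply (subst sum.swap)
  using assms by (auto simp: scalar_prod_def power2_eq_square atLeast0LessThan intro!: sum.cong)

lemma frobenius_norm_transpose:
  assumes "A \<in> carrier_mat r c"
  shows "frobenius_norm A\<^sup>T = frobenius_norm A"
proof -
  have "(frobenius_norm A\<^sup>T)\<^sup>2 = (frobenius_norm A)\<^sup>2"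
    using assms frobenius_norm_sq[of "A\<^sup>T" c r] frobenius_norm_sq[OF assms]
    by (simp add: sum.swap[of _ "{..<c}"])
  then show ?thesis by simp
qed

lemma frobenius_norm_add_le:
  assumes "A \<in> carrier_mat r c" "B \<in> carrier_mat r c"
  shows "frobenius_norm (A + B) \<le> frobenius_norm A + frobenius_norm B"
proof -
  have "frobenius_norm (A + B) = L2_set (\<lambda>ij. A $$ ij + B $$ ij) ({..<r} \<times> {..<c})"
    using assms unfolding frobenius_norm_def by (auto intro!: L2_set_cong)
  then show ?thesis
    using assms L2_set_triangle_ineq[of "\<lambda>ij. A $$ ij" "\<lambda>ij. B $$ ij" "{..<r} \<times> {..<c}"]
    by (simp add: frobenius_norm_def)
qed

lemma frobenius_norm_smult: "frobenius_norm (c \<cdot>\<^sub>m A) = \<bar>c\<bar> * frobenius_norm A"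
proof -
  have "frobenius_norm (c \<cdot>\<^sub>m A) = L2_set (\<lambda>ij. c * A $$ ij) ({..<dim_row A} \<times> {..<dim_col A})"
    unfolding frobenius_norm_def by (auto intro!: L2_set_cong)
  also have "\<dots> = \<bar>c\<bar> * frobenius_norm A"
    unfolding frobenius_norm_def L2_set_def
    by (simp add: power_mult_distrib sum_distrib_left[symmetric] real_sqrt_mult)
  finally show ?thesis .
qed

text \<open>The spectral norm is a supremum, so every use of it needs a witness bound. Working with the
  predicate that \<open>K\<close> is such a bound avoids carrying suprema through products, sums and transposes;
  they return only in \<open>spectral_norm_le\<close>.\<close>

definition opnorm_le :: "real mat \<Rightarrow> real \<Rightarrow> bool" where
  "opnorm_le A K \<longleftrightarrow> 0 \<le> K \<and> (\<forall>x\<in>carrier_vec (dim_col A). vnorm (A *\<^sub>v x) \<le> K * vnorm x)"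

lemma opnorm_leD:
  "opnorm_le A K \<Longrightarrow> A \<in> carrier_mat r c \<Longrightarrow> x \<in> carrier_vec c \<Longrightarrow> vnorm (A *\<^sub>v x) \<le> K * vnorm x"
  by (auto simp: opnorm_le_def)

lemma opnorm_leI:
  "0 \<le> K \<Longrightarrow> A \<in> carrier_mat r c \<Longrightarrow> (\<And>x. x \<in> carrier_vec c \<Longrightarrow> vnorm (A *\<^sub>v x) \<le> K * vnorm x)
    \<Longrightarrow> opnorm_le A K"
  by (auto simp: opnorm_le_def)

lemma opnorm_le_nonneg: "opnorm_le A K \<Longrightarrow> 0 \<le> K"
  by (simp add: opnorm_le_def)

lemma vnorm_zero [simp]: "vnorm (0\<^sub>v n) = 0"
  by (simp add: vnorm_def L2_set_def)

lemma opnorm_le_mult: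
  assumes A: "A \<in> carrier_mat r n" "opnorm_le A K" and B: "B \<in> carrier_mat n c" "opnorm_le B L"
  shows "opnorm_le (A * B) (K * L)"
proof (rule opnorm_leI[of _ _ r c])
  fix x :: "real vec" assume x: "x \<in> carrier_vec c"
  have "vnorm ((A * B) *\<^sub>v x) = vnorm (A *\<^sub>v (B *\<^sub>v x))" using A B x by simp
  also have "\<dots> \<le> K * vnorm (B *\<^sub>v x)" using A B x by (intro opnorm_leD) auto
  also have "\<dots> \<le> K * (L * vnorm x)" using A B x
    by (intro mult_left_mono opnorm_leD[OF B(2,1)] opnorm_le_nonneg) auto
  finally show "vnorm ((A * B) *\<^sub>v x) \<le> K * L * vnorm x" by simp
qed (use A B opnorm_le_nonneg in auto)

lemma opnorm_le_add:
  assumes A: "A \<in> carrier_mat r c" "opnorm_le A K" and B: "B \<in> carrier_mat r c" "opnorm_le B L"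
  shows "opnorm_le (A + B) (K + L)"
proof (rule opnorm_leI[of _ _ r c])
  fix x :: "real vec" assume x: "x \<in> carrier_vec c"
  have "vnorm ((A + B) *\<^sub>v x) = vnorm (A *\<^sub>v x + B *\<^sub>v x)"
    using A B x by (simp add: add_mult_distrib_mat_vec[of _ r c])
  also have "\<dots> \<le> vnorm (A *\<^sub>v x) + vnorm (B *\<^sub>v x)" using A B x by (intro vnorm_add_le[of _ r]) auto
  also have "\<dots> \<le> K * vnorm x + L * vnorm x" using A B x
    by (intro add_mono opnorm_leD) auto
  finally show "vnorm ((A + B) *\<^sub>v x) \<le> (K + L) * vnorm x" by (simp add: algebra_simps)
qed (use A B opnorm_le_nonneg in \<open>auto simp: add_nonneg_nonneg\<close>)

lemma opnorm_le_smult_one: "opnorm_le (c \<cdot>\<^sub>m 1\<^sub>m n) \<bar>c\<bar>"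
proof (rule opnorm_leI[of _ _ n n])
  fix x :: "real vec" assume x: "x \<in> carrier_vec n"
  have "(c \<cdot>\<^sub>m 1\<^sub>m n) *\<^sub>v x = c \<cdot>\<^sub>v x" using x by auto
  then show "vnorm ((c \<cdot>\<^sub>m 1\<^sub>m n) *\<^sub>v x) \<le> \<bar>c\<bar> * vnorm x" by (simp add: vnorm_smult)
qed auto

text \<open>With \<open>y = A\<^sup>T x\<close> one has \<open>y \<bullet> y = x \<bullet> A y\<close>, and Cauchy--Schwarz bounds the right-hand side by
  \<open>K\<close> times the norms of \<open>x\<close> and \<open>y\<close>; one factor of the norm of \<open>y\<close> cancels.\<close>

lemma opnorm_le_transpose:
  assumes A: "A \<in> carrier_mat r c" "opnorm_le A K"
  shows "opnorm_le A\<^sup>T K"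
proof (rule opnorm_leI[of _ _ c r])
  fix x :: "real vec" assume x: "x \<in> carrier_vec r"
  define y where "y = A\<^sup>T *\<^sub>v x"
  have y: "y \<in> carrier_vec c" using A x by (simp add: y_def)
  have "(vnorm y)\<^sup>2 = x \<bullet> (A *\<^sub>v y)"
    unfolding vnorm_sq using transpose_vec_mult_scalar[OF A(1) y x] A x y
    by (metis y_def transpose_carrier_mat comm_scalar_prod mult_mat_vec_carrier)
  also have "\<dots> \<le> vnorm x * vnorm (A *\<^sub>v y)" using abs_sprod_le[of x r "A *\<^sub>v y"] A x y by simp
  also have "\<dots> \<le> vnorm x * (K * vnorm y)" using A y by (intro mult_left_mono opnorm_leD) auto
  finally have "vnorm y * vnorm y \<le> (K * vnorm x) * vnorm y" by (simp add: power2_eq_square ac_simps)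
  then have "vnorm y \<le> K * vnorm x \<or> vnorm y = 0"
    by (metis mult_right_le_imp_le order_le_less vnorm_nonneg)
  then show "vnorm (A\<^sup>T *\<^sub>v x) \<le> K * vnorm x" using A opnorm_le_nonneg by (auto simp: y_def)
qed (use A opnorm_le_nonneg in auto)

text \<open>The squared Frobenius norm is the sum of the squared column norms, and left multiplication by \<open>A\<close>
  acts on each column separately. Transposition gives the version for right multiplication.\<close>

lemma frobenius_mult_le_left:
  assumes A: "A \<in> carrier_mat r n" "opnorm_le A K" and B: "B \<in> carrier_mat n c"
  shows "frobenius_norm (A * B) \<le> K * frobenius_norm B"
proof (rule power2_le_imp_le)
  have "(frobenius_norm (A * B))\<^sup>2 = (\<Sum>j<c. (vnorm (A *\<^sub>v col B j))\<^sup>2)"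
    using A B by (subst frobenius_norm_sq_cols[of _ r c]) (auto simp: col_mult2[of A r n B c] simp del: col_mult)
  also have "\<dots> \<le> (\<Sum>j<c. (K * vnorm (col B j))\<^sup>2)"
    using A B by (intro sum_mono power_mono opnorm_leD) auto
  also have "\<dots> = (K * frobenius_norm B)\<^sup>2"
    unfolding power_mult_distrib frobenius_norm_sq_cols[OF B] by (simp add: sum_distrib_left)
  finally show "(frobenius_norm (A * B))\<^sup>2 \<le> (K * frobenius_norm B)\<^sup>2" .
qed (use A opnorm_le_nonneg in auto)

lemma frobenius_mult_le_right:
  assumes A: "A \<in> carrier_mat n c" "opnorm_le A K" and B: "B \<in> carrier_mat r n"
  shows "frobenius_norm (B * A) \<le> K * frobenius_norm B"
proof -
  have "frobenius_norm (B * A) = frobenius_norm (A\<^sup>T * B\<^sup>T)"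
    using A B frobenius_norm_transpose[of "B * A" r c] by (simp add: transpose_mult[of B r n A c])
  also have "\<dots> \<le> K * frobenius_norm B\<^sup>T"
    using A B by (intro frobenius_mult_le_left[of _ c n] opnorm_le_transpose[of _ n c]) auto
  finally show ?thesis using B by (simp add: frobenius_norm_transpose)
qed

lemma opnorm_le_frobenius:
  assumes "A \<in> carrier_mat r c"
  shows "opnorm_le A (frobenius_norm A)"
proof (rule opnorm_leI[OF _ assms])
  fix x :: "real vec" assume x: "x \<in> carrier_vec c"
  show "vnorm (A *\<^sub>v x) \<le> frobenius_norm A * vnorm x"
  proof (rule power2_le_imp_le)
    have "(vnorm (A *\<^sub>v x))\<^sup>2 = (\<Sum>i<r. (row A i \<bullet> x)\<^sup>2)"
      using assms unfolding vnorm_sq by (subst scalar_prod_def) (auto simp: power2_eq_square atLeast0LessThan)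
    also have "\<dots> \<le> (\<Sum>i<r. (vnorm (row A i) * vnorm x)\<^sup>2)"
      using assms x by (intro sum_mono abs_le_square_iff[THEN iffD1])
        (auto intro!: abs_sprod_le[of _ c])
    also have "\<dots> = (\<Sum>i<r. (vnorm (row A i))\<^sup>2) * (vnorm x)\<^sup>2"
      by (simp add: power_mult_distrib sum_distrib_right)
    also have "(\<Sum>i<r. (vnorm (row A i))\<^sup>2) = (frobenius_norm A)\<^sup>2"
      using assms by (subst frobenius_norm_transpose[OF assms, symmetric], subst frobenius_norm_sq_cols[of _ c r]) auto
    finally show "(vnorm (A *\<^sub>v x))\<^sup>2 \<le> (frobenius_norm A * vnorm x)\<^sup>2" by (simp add: power_mult_distrib)
  qed auto
qed auto

lemma spectral_norm_le:
  assumes "opnorm_le A K"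
  shows "spectral_norm A \<le> K"
  unfolding spectral_norm_def
proof (rule cSUP_least)
  show "{x \<in> carrier_vec (dim_col A). vnorm x \<le> 1} \<noteq> {}"
    by (rule ex_in_conv[THEN iffD1], rule exI[of _ "0\<^sub>v (dim_col A)"]) simp
next
  fix x :: "real vec" assume "x \<in> {x \<in> carrier_vec (dim_col A). vnorm x \<le> 1}"
  then have "vnorm (A *\<^sub>v x) \<le> K * vnorm x" "K * vnorm x \<le> K * 1" using assms
    mult_left_mono[of "vnorm x" 1 K] by (auto simp: opnorm_le_def)
  then show "vnorm (A *\<^sub>v x) \<le> K" by simp
qed

lemma isometry_sprod:
  assumes V: "V \<in> carrier_mat n k" "V\<^sup>T * V = 1\<^sub>m k" and x: "x \<in> carrier_vec k"
  shows "(V *\<^sub>v x) \<bullet> (V *\<^sub>v x) = x \<bullet> (x :: real vec)"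
proof -
  have VT: "V\<^sup>T \<in> carrier_mat k n" using V by simp
  have "(V *\<^sub>v x) \<bullet> (V *\<^sub>v x) = (V\<^sup>T *\<^sub>v (V *\<^sub>v x)) \<bullet> x"
    using transpose_vec_mult_scalar[OF V(1) x, of "V *\<^sub>v x"] V x by simp
  also have "V\<^sup>T *\<^sub>v (V *\<^sub>v x) = x" using V VT x by (metis assoc_mult_mat_vec one_mult_mat_vec)
  finally show ?thesis .
qed

lemma opnorm_le_isometry:
  assumes "V \<in> carrier_mat n k" "V\<^sup>T * V = 1\<^sub>m k"
  shows "opnorm_le V 1"
  by (rule opnorm_leI[OF _ assms(1)]) (simp_all add: vnorm_eq_sqrt isometry_sprod[OF assms])

lemma vnorm_sq_sum: "x \<in> carrier_vec n \<Longrightarrow> x \<bullet> x = (\<Sum>i<n. (x $ i)\<^sup>2)" for x :: "real vec"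
  by (auto simp: scalar_prod_def power2_eq_square atLeast0LessThan)

text \<open>Used both for \<open>Z \<Psi> Z\<^sup>T\<close> and, with \<open>V\<^sup>T\<close> in place of \<open>Z\<close>, for the compression \<open>V\<^sup>T \<Sigma> V\<close>.\<close>

lemma quadratic_form_sandwich:
  assumes "Z \<in> carrier_mat n k" "B \<in> carrier_mat k k" "x \<in> carrier_vec n"
  shows "x \<bullet> ((Z * B * Z\<^sup>T) *\<^sub>v x) = (Z\<^sup>T *\<^sub>v x) \<bullet> (B *\<^sub>v (Z\<^sup>T *\<^sub>v (x :: real vec)))"
proof -
  have ZT: "Z\<^sup>T \<in> carrier_mat k n" using assms by simp
  define y where "y = Z\<^sup>T *\<^sub>v x"
  have y: "y \<in> carrier_vec k" using ZT assms by (simp add: y_def)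
  have "(Z * B * Z\<^sup>T) *\<^sub>v x = Z *\<^sub>v (B *\<^sub>v y)"
    unfolding y_def assoc_mult_mat_vec[OF mult_carrier_mat[OF assms(1,2)] ZT assms(3)]
    using assoc_mult_mat_vec[OF assms(1,2)] y by (simp add: y_def)
  then show ?thesis
    using transpose_vec_mult_scalar[OF assms(1), of "B *\<^sub>v y" x] assms y by (simp add: y_def)
qed

section \<open>The spectral theorem for real symmetric matrices\<close>

text \<open>Over the complex numbers an eigenvalue \<open>c\<close> exists, with an eigenvector \<open>x + i y\<close>. Comparing
  \<open>(A x) \<bullet> y\<close> with \<open>x \<bullet> (A y)\<close> shows that the imaginary part of \<open>c\<close> times \<open>x \<bullet> x + y \<bullet> y\<close>
  vanishes, so \<open>c\<close> is real, and whichever of \<open>x\<close> and \<open>y\<close> is nonzero is a real eigenvector.\<close>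

lemma sym_real_eigenvalue_ex:
  fixes A :: "real mat"
  assumes A: "A \<in> carrier_mat n n" "A\<^sup>T = A" and n: "n > 0"
  shows "\<exists>v e. v \<in> carrier_vec n \<and> v \<noteq> 0\<^sub>v n \<and> A *\<^sub>v v = e \<cdot>\<^sub>v v"
proof -
  define AC where "AC = map_mat complex_of_real A"
  have AC: "AC \<in> carrier_mat n n" using A by (simp add: AC_def)
  from spectrum_non_empty[OF AC n] obtain c z where z: "z \<in> carrier_vec n" "z \<noteq> 0\<^sub>v n"
    and eq: "AC *\<^sub>v z = c \<cdot>\<^sub>v z"
    using AC unfolding spectrum_def eigenvalue_def eigenvector_def by auto
  define x y where "x = map_vec Re z" and "y = map_vec Im z"
  have x: "x \<in> carrier_vec n" and y: "y \<in> carrier_vec n" using z by (auto simp: x_def y_def)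
  have Ax: "A *\<^sub>v x = Re c \<cdot>\<^sub>v x + (- Im c) \<cdot>\<^sub>v y"
  proof (rule eq_vecI)
    fix i assume "i < dim_vec (Re c \<cdot>\<^sub>v x + (- Im c) \<cdot>\<^sub>v y)"
    then have i: "i < n" using y by simp
    have "Re ((AC *\<^sub>v z) $ i) = Re ((c \<cdot>\<^sub>v z) $ i)" by (simp add: eq)
    then show "(A *\<^sub>v x) $ i = (Re c \<cdot>\<^sub>v x + (- Im c) \<cdot>\<^sub>v y) $ i"
      using i A z by (simp add: AC_def x_def y_def scalar_prod_def)
  qed (use A y in simp)
  have Ay: "A *\<^sub>v y = Im c \<cdot>\<^sub>v x + Re c \<cdot>\<^sub>v y"
  proof (rule eq_vecI)
    fix i assume "i < dim_vec (Im c \<cdot>\<^sub>v x + Re c \<cdot>\<^sub>v y)"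
    then have i: "i < n" using y by simp
    have "Im ((AC *\<^sub>v z) $ i) = Im ((c \<cdot>\<^sub>v z) $ i)" by (simp add: eq)
    then show "(A *\<^sub>v y) $ i = (Im c \<cdot>\<^sub>v x + Re c \<cdot>\<^sub>v y) $ i"
      using i A z by (simp add: AC_def x_def y_def scalar_prod_def)
  qed (use A y in simp)
  have "(A *\<^sub>v x) \<bullet> y = x \<bullet> (A *\<^sub>v y)"
    using transpose_vec_mult_scalar[OF A(1) y x] A(2) by simp
  then have "Im c * (x \<bullet> x + y \<bullet> y) = 0"
    unfolding Ax Ay using x y comm_scalar_prod[OF x y]
    by (simp add: add_scalar_prod_distrib[of _ n] scalar_prod_add_distrib[of _ n] algebra_simps)
  moreover have xy: "x \<noteq> 0\<^sub>v n \<or> y \<noteq> 0\<^sub>v n"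
  proof (rule ccontr)
    assume "\<not> ?thesis"
    then have xy0: "x = 0\<^sub>v n" "y = 0\<^sub>v n" by auto
    have "z $ i = 0" if "i < n" for i
      using that z arg_cong[OF xy0(1), of "\<lambda>v. v $ i"] arg_cong[OF xy0(2), of "\<lambda>v. v $ i"]
      by (simp add: x_def y_def complex_eq_iff)
    then show False using z by (metis carrier_vecD eq_vecI index_zero_vec)
  qed
  moreover have "x \<bullet> x + y \<bullet> y \<noteq> 0"
    using xy x y by (metis add_nonneg_eq_0_iff sprod_self_eq_0 sprod_self_nonneg)
  ultimately have "Im c = 0" by simp
  then have "A *\<^sub>v x = Re c \<cdot>\<^sub>v x" "A *\<^sub>v y = Re c \<cdot>\<^sub>v y" unfolding Ax Ay using x y
    by (auto intro!: eq_vecI)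
  then show ?thesis using xy x y by blast
qed

lemma conjugate_real_vec: "conjugate (x :: real vec) = x"
  by (rule eq_vecI) simp_all

text \<open>Complete \<open>v\<close> to a basis, apply Gram--Schmidt, which keeps the first vector, and normalize.\<close>

lemma orthogonal_mat_with_first_col:
  assumes v: "v \<in> carrier_vec n" "v \<noteq> 0\<^sub>v n"
  shows "\<exists>U c. U \<in> carrier_mat n n \<and> U\<^sup>T * U = 1\<^sub>m n \<and> col U 0 = (c::real) \<cdot>\<^sub>v v"
proof -
  interpret cof_vec_space n "TYPE(real)" .
  define b where "b = basis_completion v"
  define ws where "ws = gram_schmidt n b"
  note bc = basis_completion[OF v, folded b_def]
  note gs = gram_schmidt_result[OF bc(2,4,5) ws_def]
  have n: "n > 0" using v by (cases n) auto
  have len: "length ws = n" using gs(4) bc(6) by simp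
  have hd: "ws ! 0 = v"
  proof -
    obtain vs where "b = v # vs" using bc(6,7) n by (cases b) auto
    then have "hd ws = v" using gram_schmidt_hd[OF v(1), of vs] by (simp add: ws_def)
    then show ?thesis using len n by (simp add: hd_conv_nth[symmetric] length_greater_0_conv[symmetric] del: length_greater_0_conv)
  qed
  have orth: "ws ! i \<bullet> ws ! j = 0 \<longleftrightarrow> i \<noteq> j" if "i < n" "j < n" for i j
    using corthogonalD[OF gs(2), of i j] that len
    by (simp add: conjugate_real_vec)
  have car: "ws ! i \<in> carrier_vec n" if "i < n" for i using gs(3) that len nth_mem by blast
  define us where "us = map (\<lambda>w. (1 / vnorm w) \<cdot>\<^sub>v w) ws"
  define U where "U = mat_of_cols n us"
  have U: "U \<in> carrier_mat n n" using len by (simp add: U_def us_def mat_of_cols_def)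
  have colU: "col U i = (1 / vnorm (ws ! i)) \<cdot>\<^sub>v (ws ! i)" if "i < n" for i
    using that len car[OF that] by (simp add: U_def us_def)
  have "U\<^sup>T * U = 1\<^sub>m n"
  proof (rule eq_matI)
    fix i j assume "i < dim_row (1\<^sub>m n :: real mat)" "j < dim_col (1\<^sub>m n :: real mat)"
    then have ij: "i < n" "j < n" by auto
    have "(U\<^sup>T * U) $$ (i, j) = col U i \<bullet> col U j" using U ij by simp
    also have "\<dots> = (1 / vnorm (ws ! i)) * (1 / vnorm (ws ! j)) * (ws ! i \<bullet> ws ! j)"
      unfolding colU[OF ij(1)] colU[OF ij(2)] using car[OF ij(1)] car[OF ij(2)] by simp
    also have "\<dots> = 1\<^sub>m n $$ (i, j)"
    proof (cases "i = j")
      case True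
      then have "ws ! i \<bullet> ws ! i \<noteq> 0" using orth[OF ij] by simp
      moreover have "vnorm (ws ! i) \<noteq> 0" using calculation by (simp add: vnorm_eq_sqrt)
      ultimately show ?thesis using True ij vnorm_sq[of "ws ! i"]
        by (simp add: power2_eq_square field_simps)
    qed (use orth[OF ij] ij in simp)
    finally show "(U\<^sup>T * U) $$ (i, j) = 1\<^sub>m n $$ (i, j)" .
  qed (use U in auto)
  then show ?thesis using U colU[OF n] hd by auto
qed

definition diag_of :: "nat \<Rightarrow> (nat \<Rightarrow> real) \<Rightarrow> real mat" where
  "diag_of n d = mat n n (\<lambda>(i, j). if i = j then d i else 0)"

lemma diag_of_carrier: "diag_of n d \<in> carrier_mat n n"
  by (simp add: diag_of_def)

text \<open>Peels off the first diagonal entry; this is the form in which the induction of the spectral theorem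
  assembles its diagonal matrix.\<close>

lemma diag_of_Suc:
  "diag_of (Suc k) (case_nat e d)
    = four_block_mat (mat 1 1 (\<lambda>_. e)) (0\<^sub>m 1 k) (0\<^sub>m k 1) (diag_of k d)"
  by (rule eq_matI) (auto simp: diag_of_def four_block_mat_def split: nat.splits)

lemma mult_block_diag2:
  assumes "A \<in> carrier_mat r1 k1" "B \<in> carrier_mat r2 k2" "C \<in> carrier_mat k1 c1" "D \<in> carrier_mat k2 c2"
  shows "four_block_mat A (0\<^sub>m r1 k2) (0\<^sub>m r2 k1) B * four_block_mat C (0\<^sub>m k1 c2) (0\<^sub>m k2 c1) D
    = (four_block_mat (A * C) (0\<^sub>m r1 c2) (0\<^sub>m r2 c1) (B * D) :: real mat)"
  using assms left_mult_zero_mat[OF assms(4)] left_mult_zero_mat[OF assms(3)]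
    right_mult_zero_mat[OF assms(1)] right_mult_zero_mat[OF assms(2)]
  by (subst mult_four_block_mat[OF assms(1) zero_carrier_mat zero_carrier_mat assms(2,3)
    zero_carrier_mat zero_carrier_mat assms(4)]) simp

text \<open>By deflation: in an orthonormal basis that starts with an eigenvector, the first column of the
  matrix is a multiple of the first unit vector. By symmetry so is the first row, and what remains is
  a symmetric matrix of size one less.\<close>

theorem spectral_decomposition:
  assumes "A \<in> carrier_mat n n" "A\<^sup>T = A"
  shows "\<exists>U d. U \<in> carrier_mat n n \<and> U\<^sup>T * U = 1\<^sub>m n \<and> U * U\<^sup>T = 1\<^sub>m n \<and> A = U * diag_of n d * U\<^sup>T"
  using assms
proof (induction n arbitrary: A)
  case 0
  then show ?case by (intro exI[of _ "1\<^sub>m 0"]) (auto intro!: eq_matI)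
next
  case (Suc k)
  let ?n = "Suc k"
  note A = Suc.prems
  obtain v e where v: "v \<in> carrier_vec ?n" "v \<noteq> 0\<^sub>v ?n" and ev: "A *\<^sub>v v = e \<cdot>\<^sub>v v"
    using sym_real_eigenvalue_ex[OF A] by auto
  obtain U c where U: "U \<in> carrier_mat ?n ?n" "U\<^sup>T * U = 1\<^sub>m ?n" and cU: "col U 0 = c \<cdot>\<^sub>v v"
    using orthogonal_mat_with_first_col[OF v] by blast
  have UU: "U * U\<^sup>T = 1\<^sub>m ?n"
    using mat_mult_left_right_inverse[of "U\<^sup>T" ?n U] U by simp
  have UT: "U\<^sup>T \<in> carrier_mat ?n ?n" using U by simp
  define B where "B = U\<^sup>T * A * U"
  have B: "B \<in> carrier_mat ?n ?n" using U A by (simp add: B_def)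
  have Bsym: "B\<^sup>T = B"
    unfolding B_def using U A
    by (simp add: transpose_mult[of _ ?n ?n _ ?n] assoc_mult_mat[of _ ?n ?n _ ?n _ ?n])
  have c0: "col U 0 \<in> carrier_vec ?n" using U(1) by (metis carrier_matD(1) carrier_vecI dim_col)
  have "col B 0 = U\<^sup>T *\<^sub>v (A *\<^sub>v col U 0)"
    unfolding B_def using U A
    by (subst col_mult2[of _ ?n ?n _ ?n]) (auto intro!: assoc_mult_mat_vec[of _ ?n ?n _ ?n] col_carrier_vec)
  also have "A *\<^sub>v col U 0 = e \<cdot>\<^sub>v col U 0"
    unfolding cU using A v ev by (simp add: mult_mat_vec[of _ ?n ?n] smult_smult_assoc mult.commute)
  also have "U\<^sup>T *\<^sub>v (e \<cdot>\<^sub>v col U 0) = e \<cdot>\<^sub>v (U\<^sup>T *\<^sub>v col U 0)"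
    by (rule mult_mat_vec[OF UT c0])
  also have "U\<^sup>T *\<^sub>v col U 0 = col (U\<^sup>T * U) 0"
    using U UT by (subst col_mult2[of _ ?n ?n _ ?n]) auto
  finally have colB: "col B 0 = e \<cdot>\<^sub>v unit_vec ?n 0" unfolding U(2) by simp
  have B0: "B $$ (i, 0) = (if i = 0 then e else 0)" if "i < ?n" for i
    using arg_cong[OF colB, of "\<lambda>v. v $ i"] that B by (auto simp: unit_vec_def)
  have B0': "B $$ (0, i) = (if i = 0 then e else 0)" if "i < ?n" for i
    using B0[OF that] Bsym B that index_transpose_mat(1)[of 0 B i] by auto
  define A3 where "A3 = mat k k (\<lambda>(i, j). B $$ (Suc i, Suc j))"
  have A3: "A3 \<in> carrier_mat k k" by (simp add: A3_def)
  have "A3\<^sup>T = A3"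
  proof (rule eq_matI)
    fix i j assume "i < dim_row A3" "j < dim_col A3"
    then show "A3\<^sup>T $$ (i, j) = A3 $$ (i, j)"
      using arg_cong[OF Bsym, of "\<lambda>B. B $$ (Suc i, Suc j)"] B by (auto simp: A3_def)
  qed (auto simp: A3_def)
  from Suc.IH[OF A3 this] obtain W d where W: "W \<in> carrier_mat k k" "W\<^sup>T * W = 1\<^sub>m k" "W * W\<^sup>T = 1\<^sub>m k"
    and A3eq: "A3 = W * diag_of k d * W\<^sup>T" by blast
  have Bblock: "B = four_block_mat (mat 1 1 (\<lambda>_. e)) (0\<^sub>m 1 k) (0\<^sub>m k 1) A3"
  proof (rule eq_matI)
    fix i j assume "i < dim_row (four_block_mat (mat 1 1 (\<lambda>_. e)) (0\<^sub>m 1 k) (0\<^sub>m k 1) A3)"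
      "j < dim_col (four_block_mat (mat 1 1 (\<lambda>_. e)) (0\<^sub>m 1 k) (0\<^sub>m k 1) A3)"
    then have "i < ?n" "j < ?n" using A3 by auto
    then show "B $$ (i, j) = four_block_mat (mat 1 1 (\<lambda>_. e)) (0\<^sub>m 1 k) (0\<^sub>m k 1) A3 $$ (i, j)"
      using B0[of i] B0'[of j] A3 by (auto simp: A3_def)
  qed (use B A3 in auto)
  define W' where "W' = four_block_mat (1\<^sub>m 1) (0\<^sub>m 1 k) (0\<^sub>m k 1) W"
  have W': "W' \<in> carrier_mat ?n ?n" using W by (auto simp: W'_def)
  have W'T: "W'\<^sup>T = four_block_mat (1\<^sub>m 1) (0\<^sub>m 1 k) (0\<^sub>m k 1) W\<^sup>T"
    unfolding W'_def using W by (subst transpose_four_block_mat[of _ 1 1 _ k _ k]) auto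
  have one: "four_block_mat (1\<^sub>m 1) (0\<^sub>m 1 k) (0\<^sub>m k 1) (1\<^sub>m k) = (1\<^sub>m ?n :: real mat)"
    by (rule eq_matI) auto
  have WT: "W\<^sup>T \<in> carrier_mat k k" using W by simp
  have W'1: "W'\<^sup>T * W' = 1\<^sub>m ?n"
    unfolding W'T unfolding W'_def mult_block_diag2[OF one_carrier_mat WT one_carrier_mat W(1)] W(2)
    using one by simp
  have W'2: "W' * W'\<^sup>T = 1\<^sub>m ?n"
    using mat_mult_left_right_inverse[of "W'\<^sup>T" ?n W'] W' W'1 by simp
  let ?e = "mat 1 1 (\<lambda>_. e) :: real mat"
  have e: "?e \<in> carrier_mat 1 1" by simp
  have "W' * diag_of ?n (case_nat e d)
      = four_block_mat ?e (0\<^sub>m 1 k) (0\<^sub>m k 1) (W * diag_of k d)"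
    unfolding diag_of_Suc W'_def mult_block_diag2[OF one_carrier_mat W(1) e diag_of_carrier]
    by simp
  moreover have "four_block_mat ?e (0\<^sub>m 1 k) (0\<^sub>m k 1) (W * diag_of k d) * W'\<^sup>T = B"
    unfolding W'T mult_block_diag2[OF e mult_carrier_mat[OF W(1) diag_of_carrier] one_carrier_mat WT]
    using Bblock A3eq by simp
  ultimately have Beq: "W' * diag_of ?n (case_nat e d) * W'\<^sup>T = B" by simp
  let ?D = "diag_of ?n (case_nat e d)"
  note car = U(1) UT W' A(1) B diag_of_carrier[of ?n "case_nat e d"]
  have "U * W' * ?D * (U * W')\<^sup>T = U * (W' * ?D * W'\<^sup>T) * U\<^sup>T"
    using car by (simp add: transpose_mult[of _ ?n ?n _ ?n] assoc_mult_mat[of _ ?n ?n _ ?n _ ?n])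
  also have "\<dots> = (U * U\<^sup>T) * A * (U * U\<^sup>T)"
    unfolding Beq B_def using car by (simp add: assoc_mult_mat[of _ ?n ?n _ ?n _ ?n])
  also have "\<dots> = A" using car by (simp add: UU)
  finally have "A = U * W' * ?D * (U * W')\<^sup>T" by simp
  moreover have "(U * W')\<^sup>T * (U * W') = W'\<^sup>T * (U\<^sup>T * U) * W'"
    using car by (simp add: transpose_mult[of _ ?n ?n _ ?n] assoc_mult_mat[of _ ?n ?n _ ?n _ ?n])
  then have UW: "(U * W')\<^sup>T * (U * W') = 1\<^sub>m ?n" using car by (simp add: U(2) W'1)
  moreover have "(U * W') * (U * W')\<^sup>T = 1\<^sub>m ?n"
    using mat_mult_left_right_inverse[of "(U * W')\<^sup>T" ?n "U * W'"] car UW by simp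
  ultimately show ?case using mult_carrier_mat[OF U(1) W'] by blast
qed

lemma spectral_quadratic_form:
  assumes U: "U \<in> carrier_mat n n" "U * U\<^sup>T = 1\<^sub>m n" and A: "A = U * diag_of n d * U\<^sup>T"
    and x: "x \<in> carrier_vec n"
  shows "x \<bullet> (A *\<^sub>v x) = (\<Sum>i<n. d i * ((U\<^sup>T *\<^sub>v x) $ i)\<^sup>2)" (is ?quad)
    and "x \<bullet> x = (\<Sum>i<n. ((U\<^sup>T *\<^sub>v x) $ i)\<^sup>2)" (is ?norm)
proof -
  define y where "y = U\<^sup>T *\<^sub>v x"
  have y: "y \<in> carrier_vec n" using U x by (simp add: y_def)
  have move: "x \<bullet> (U *\<^sub>v z) = y \<bullet> z" if "z \<in> carrier_vec n" for z
    using transpose_vec_mult_scalar[OF U(1) that x] by (simp add: y_def)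
  have Ax: "A *\<^sub>v x = U *\<^sub>v (diag_of n d *\<^sub>v y)"
    unfolding A y_def using U x diag_of_carrier[of n d] by (simp add: assoc_mult_mat_vec[of _ n n _ n])
  have Dy: "(diag_of n d *\<^sub>v y) $ i = d i * y $ i" if "i < n" for i
    using that y by (simp add: diag_of_def scalar_prod_def if_distrib[where f="\<lambda>c. c * _"] cong: if_cong)
  have Dyc: "diag_of n d *\<^sub>v y \<in> carrier_vec n" by (rule mult_mat_vec_carrier[OF diag_of_carrier y])
  have "x \<bullet> (A *\<^sub>v x) = y \<bullet> (diag_of n d *\<^sub>v y)" unfolding Ax by (rule move[OF Dyc])
  also have "\<dots> = (\<Sum>i<n. y $ i * (diag_of n d *\<^sub>v y) $ i)"
    using Dyc by (subst scalar_prod_def) (simp add: atLeast0LessThan diag_of_def)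
  also have "\<dots> = (\<Sum>i<n. d i * (y $ i)\<^sup>2)"
    by (intro sum.cong) (auto simp: Dy power2_eq_square)
  finally show ?quad by (simp add: y_def)
  have "x = U *\<^sub>v y" unfolding y_def using U x
    by (metis assoc_mult_mat_vec one_mult_mat_vec transpose_carrier_mat)
  then have "x \<bullet> x = y \<bullet> y" using move[OF y] by simp
  then show ?norm using vnorm_sq_sum[OF y] by (simp add: y_def)
qed

lemma spectral_eigenvalue:
  assumes U: "U \<in> carrier_mat n n" "U\<^sup>T * U = 1\<^sub>m n" and A: "A = U * diag_of n d * U\<^sup>T"
    and i: "i < n"
  shows "A *\<^sub>v col U i = d i \<cdot>\<^sub>v col U i" "col U i \<in> carrier_vec n" "col U i \<bullet> col U i = 1"
    "eigenvalue A (d i)"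
proof -
  show cU: "col U i \<in> carrier_vec n" using U i by auto
  have "U\<^sup>T *\<^sub>v col U i = col (U\<^sup>T * U) i" using U i by (subst col_mult2[of _ n n _ n]) auto
  then have 1: "U\<^sup>T *\<^sub>v col U i = unit_vec n i" unfolding U(2) using i by simp
  have 2: "diag_of n d *\<^sub>v unit_vec n i = d i \<cdot>\<^sub>v unit_vec n i"
    using i by (intro eq_vecI) (auto simp: diag_of_def)
  have 3: "U *\<^sub>v unit_vec n i = col U i" using U i by (intro eq_vecI) auto
  have "A *\<^sub>v col U i = U *\<^sub>v (diag_of n d *\<^sub>v (U\<^sup>T *\<^sub>v col U i))"
    unfolding A using U cU diag_of_carrier[of n d] by (simp add: assoc_mult_mat_vec[of _ n n _ n])
  also have "\<dots> = d i \<cdot>\<^sub>v col U i" unfolding 1 2 using U 3 by (simp add: mult_mat_vec[of _ n n])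
  finally show ev: "A *\<^sub>v col U i = d i \<cdot>\<^sub>v col U i" .
  have "col U i \<bullet> col U i = (U\<^sup>T * U) $$ (i, i)" using U(1) i by simp
  then show "col U i \<bullet> col U i = 1" unfolding U(2) using i by simp
  then have "col U i \<noteq> 0\<^sub>v n" using sprod_self_eq_0[OF cU] by simp
  then show "eigenvalue A (d i)"
    using ev cU A U by (auto simp: eigenvalue_def eigenvector_def intro!: exI[of _ "col U i"])
qed

text \<open>Turns the hypotheses on extreme eigenvalues of \<open>Z\<^sub>i\<^sup>T Z\<^sub>i\<close> into two-sided bounds on the norm of
  \<open>Z\<^sub>i y\<close>, the only form in which they are used.\<close>

lemma rayleigh_bounds:
  assumes A: "A \<in> carrier_mat n n" "A\<^sup>T = A" and x: "x \<in> carrier_vec n"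
  shows "eig_min A * (x \<bullet> x) \<le> x \<bullet> (A *\<^sub>v x)" "x \<bullet> (A *\<^sub>v x) \<le> eig_max A * (x \<bullet> x)"
proof -
  obtain U d where U: "U \<in> carrier_mat n n" "U\<^sup>T * U = 1\<^sub>m n" "U * U\<^sup>T = 1\<^sub>m n"
    and Aeq: "A = U * diag_of n d * U\<^sup>T" using spectral_decomposition[OF A] by blast
  note q = spectral_quadratic_form[OF U(1,3) Aeq x]
  have fin: "finite (spectrum A)" using card_finite_spectrum[OF A(1)] by simp
  have mem: "d i \<in> spectrum A" if "i < n" for i
    using spectral_eigenvalue(4)[OF U(1,2) Aeq that] by (simp add: spectrum_def)
  show "eig_min A * (x \<bullet> x) \<le> x \<bullet> (A *\<^sub>v x)"
    unfolding q sum_distrib_left eig_min_def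
    by (intro sum_mono mult_right_mono Min_le fin mem) auto
  show "x \<bullet> (A *\<^sub>v x) \<le> eig_max A * (x \<bullet> x)"
    unfolding q sum_distrib_left eig_max_def
    by (intro sum_mono mult_right_mono Max_ge fin mem) auto
qed

section \<open>Positive semi-definite square roots and whitening\<close>

text \<open>Let \<open>x\<close> be a unit eigenvector of \<open>B - C\<close> with eigenvalue \<open>\<mu>\<close>. Since \<open>B x\<close> and \<open>C x\<close> have the same
  norm, \<open>0 = (B x - C x) \<bullet> (B x + C x) = \<mu> (x \<bullet> B x + x \<bullet> C x)\<close>. If \<open>\<mu>\<close> were nonzero, both
  nonnegative terms would vanish, but then so would their difference \<open>\<mu>\<close>. Hence every eigenvalue of
  the symmetric matrix \<open>B - C\<close> is zero. Uniqueness is what gives the definite description in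
  \<open>psd_sqrt\<close> a value.\<close>

lemma psd_square_eq_imp_eq:
  assumes B: "B \<in> carrier_mat n n" "psd B" and C: "C \<in> carrier_mat n n" "psd C"
    and eq: "B * B = C * C"
  shows "B = C"
proof -
  define M where "M = B - C"
  have sym: "B\<^sup>T = B" "C\<^sup>T = C" using B C by (auto simp: psd_def symmetric_def)
  have M: "M \<in> carrier_mat n n" using B C by (simp add: M_def minus_carrier_mat)
  have "M\<^sup>T = M" unfolding M_def using B C sym transpose_minus[of B n n C] by simp
  then obtain U d where U: "U \<in> carrier_mat n n" "U\<^sup>T * U = 1\<^sub>m n" "U * U\<^sup>T = 1\<^sub>m n"
    and Meq: "M = U * diag_of n d * U\<^sup>T" using spectral_decomposition[OF M] by blast
  have "d i = 0" if i: "i < n" for i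
  proof -
    note ev = spectral_eigenvalue[OF U(1,2) Meq i]
    define x where "x = col U i"
    have x: "x \<in> carrier_vec n" "x \<bullet> x = 1" using ev by (auto simp: x_def)
    have Bx: "B *\<^sub>v x \<in> carrier_vec n" and Cx: "C *\<^sub>v x \<in> carrier_vec n" using B C x by auto
    have Mx: "B *\<^sub>v x - C *\<^sub>v x = d i \<cdot>\<^sub>v x"
      using ev(1) B C x by (simp add: M_def x_def minus_mult_distrib_mat_vec[of _ n n])
    have xB: "x \<bullet> (B *\<^sub>v (B *\<^sub>v x)) = (B *\<^sub>v x) \<bullet> (B *\<^sub>v x)"
      using transpose_vec_mult_scalar[OF B(1) Bx x(1)] sym by simp
    have xC: "x \<bullet> (C *\<^sub>v (C *\<^sub>v x)) = (C *\<^sub>v x) \<bullet> (C *\<^sub>v x)"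
      using transpose_vec_mult_scalar[OF C(1) Cx x(1)] sym by simp
    have "B *\<^sub>v (B *\<^sub>v x) = C *\<^sub>v (C *\<^sub>v x)"
      using arg_cong[OF eq, of "\<lambda>M. M *\<^sub>v x"] B C x by (simp add: assoc_mult_mat_vec[of _ n n _ n])
    then have sq: "(B *\<^sub>v x) \<bullet> (B *\<^sub>v x) = (C *\<^sub>v x) \<bullet> (C *\<^sub>v x)" using xB xC by simp
    have nn: "0 \<le> x \<bullet> (B *\<^sub>v x)" "0 \<le> x \<bullet> (C *\<^sub>v x)" using B C x by (auto simp: psd_def)
    have "(d i \<cdot>\<^sub>v x) \<bullet> (B *\<^sub>v x + C *\<^sub>v x) = 0"
      unfolding Mx[symmetric] using Bx Cx sq comm_scalar_prod[OF Bx Cx]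
      by (simp add: minus_scalar_prod_distrib[of _ n] scalar_prod_add_distrib[of _ n])
    then have "d i * (x \<bullet> (B *\<^sub>v x) + x \<bullet> (C *\<^sub>v x)) = 0"
      using x Bx Cx by (simp add: scalar_prod_add_distrib[of _ n] algebra_simps)
    moreover have "d i = x \<bullet> (B *\<^sub>v x) - x \<bullet> (C *\<^sub>v x)"
    proof -
      have "x \<bullet> (d i \<cdot>\<^sub>v x) = d i" using x by simp
      then show ?thesis unfolding Mx[symmetric] using x Bx Cx
        by (simp add: scalar_prod_minus_distrib[of _ n])
    qed
    ultimately show "d i = 0" using nn by (cases "d i = 0") auto
  qed
  then have "diag_of n d = 0\<^sub>m n n" by (auto simp: diag_of_def intro!: eq_matI)
  then have "M = 0\<^sub>m n n" unfolding Meq using U by simp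
  then have "M $$ (i, j) = 0" if "i < n" "j < n" for i j using that by simp
  then show "B = C" using B C by (intro eq_matI) (auto simp: M_def)
qed

lemma psd_sqrt_exists:
  assumes A: "A \<in> carrier_mat n n" "psd A"
  shows "\<exists>B. B \<in> carrier_mat n n \<and> psd B \<and> B * B = A"
proof -
  have "A\<^sup>T = A" using A by (simp add: psd_def symmetric_def)
  then obtain U d where U: "U \<in> carrier_mat n n" "U\<^sup>T * U = 1\<^sub>m n" "U * U\<^sup>T = 1\<^sub>m n"
    and Aeq: "A = U * diag_of n d * U\<^sup>T" using spectral_decomposition[OF A(1)] by blast
  have d: "0 \<le> d i" if "i < n" for i
  proof -
    note ev = spectral_eigenvalue[OF U(1,2) Aeq that]
    have "0 \<le> col U i \<bullet> (A *\<^sub>v col U i)" using A ev(2) by (auto simp: psd_def)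
    then show ?thesis unfolding ev(1) using ev(2,3) by simp
  qed
  define D where "D = diag_of n (\<lambda>i. sqrt (d i))"
  have D: "D \<in> carrier_mat n n" by (simp add: D_def diag_of_carrier)
  have DT: "D\<^sup>T = D" by (auto simp: D_def diag_of_def intro!: eq_matI)
  have DD: "D * D = diag_of n d"
    using d by (intro eq_matI) (auto simp: D_def diag_of_def scalar_prod_def if_distrib[where f="\<lambda>c. c * _"] cong: if_cong)
  define B where "B = U * D * U\<^sup>T"
  have B: "B \<in> carrier_mat n n" using U D by (simp add: B_def)
  have "B\<^sup>T = B" unfolding B_def using U D DT
    by (simp add: transpose_mult[of _ n n _ n] assoc_mult_mat[of _ n n _ n _ n])
  moreover have "0 \<le> x \<bullet> (B *\<^sub>v x)" if "x \<in> carrier_vec n" for x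
    unfolding spectral_quadratic_form(1)[OF U(1,3) B_def[unfolded D_def] that]
    using d by (intro sum_nonneg) auto
  moreover have "B * B = U * (D * (U\<^sup>T * U) * D) * U\<^sup>T"
    unfolding B_def using U(1) D by (simp add: assoc_mult_mat[of _ n n _ n _ n])
  then have "B * B = A" unfolding U(2) Aeq using D DD by simp
  ultimately show ?thesis using B by (auto simp: psd_def symmetric_def)
qed

lemma psd_sqrt:
  assumes A: "A \<in> carrier_mat n n" "psd A"
  shows "psd_sqrt A \<in> carrier_mat n n" "psd (psd_sqrt A)" "psd_sqrt A * psd_sqrt A = A"
proof -
  obtain B where B: "B \<in> carrier_mat n n" "psd B" "B * B = A" using psd_sqrt_exists[OF A] by blast
  have "psd_sqrt A = B"
    unfolding psd_sqrt_def
  proof (rule the_equality)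
    fix C assume C: "psd C \<and> C * C = A"
    then have "C \<in> carrier_mat n n" using A
      by (metis carrier_matD carrier_matI index_mult_mat(2,3) psd_def symmetric_def square_mat.simps)
    then show "C = B" using C B by (metis psd_square_eq_imp_eq)
  qed (use B in auto)
  then show "psd_sqrt A \<in> carrier_mat n n" "psd (psd_sqrt A)" "psd_sqrt A * psd_sqrt A = A"
    using B by auto
qed

lemma inv_mat:
  assumes A: "A \<in> carrier_mat n n" and inj: "\<And>x. x \<in> carrier_vec n \<Longrightarrow> A *\<^sub>v x = 0\<^sub>v n \<Longrightarrow> x = 0\<^sub>v n"
  shows "inv_mat A \<in> carrier_mat n n" "A * inv_mat A = 1\<^sub>m n" "inv_mat A * A = 1\<^sub>m n"
proof -
  have "det A \<noteq> 0" using det_0_iff_vec_prod_zero_field[OF A] inj by blast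
  then have "A \<in> Units (ring_mat TYPE(real) n ())" by (rule det_non_zero_imp_unit[OF A])
  then obtain B where "mat_inverse A = Some B" using mat_inverse(1)[OF A] by fastforce
  then show "inv_mat A \<in> carrier_mat n n" "A * inv_mat A = 1\<^sub>m n" "inv_mat A * A = 1\<^sub>m n"
    using mat_inverse(2)[OF A, of B] by (auto simp: inv_mat_def)
qed

lemma psd_if_quadratic_lower:
  assumes S: "S \<in> carrier_mat n n"
    and lo: "\<And>x. x \<in> carrier_vec n \<Longrightarrow> a * (x \<bullet> x) \<le> x \<bullet> (S *\<^sub>v x)" and a: "0 < a"
    and sym: "S\<^sup>T = S"
  shows "psd S"
proof -
  have "0 \<le> x \<bullet> (S *\<^sub>v x)" if "x \<in> carrier_vec n" for x
    using lo[OF that] mult_nonneg_nonneg[OF less_imp_le[OF a] sprod_self_nonneg[of x]] by linarith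
  then show ?thesis using S sym by (auto simp: psd_def symmetric_def)
qed

lemma vnorm_psd_sqrt_sq:
  assumes S: "S \<in> carrier_mat n n" "psd S" and x: "x \<in> carrier_vec n"
  shows "(vnorm (psd_sqrt S *\<^sub>v x))\<^sup>2 = x \<bullet> (S *\<^sub>v x)"
proof -
  note R = psd_sqrt[OF S]
  have "(psd_sqrt S)\<^sup>T = psd_sqrt S" using R(2) by (simp add: psd_def symmetric_def)
  moreover have "S *\<^sub>v x = psd_sqrt S *\<^sub>v (psd_sqrt S *\<^sub>v x)"
    using R x by (metis assoc_mult_mat_vec)
  ultimately show ?thesis
    using transpose_vec_mult_scalar[of "psd_sqrt S" n n "psd_sqrt S *\<^sub>v x" x] R x
    by (simp add: vnorm_sq)
qed

lemma inv_sqrt_posdef: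
  assumes S: "S \<in> carrier_mat n n" "psd S"
    and lo: "\<And>x. x \<in> carrier_vec n \<Longrightarrow> a * (x \<bullet> x) \<le> x \<bullet> (S *\<^sub>v x)" and a: "0 < a"
  shows "inv_sqrt S \<in> carrier_mat n n"
    and "psd_sqrt S * inv_sqrt S = 1\<^sub>m n" "inv_sqrt S * psd_sqrt S = 1\<^sub>m n"
    and "inv_sqrt S * inv_sqrt S = inv_mat S"
    and "opnorm_le (inv_sqrt S) (1 / sqrt a)"
proof -
  define R B where "R = psd_sqrt S" and "B = inv_sqrt S"
  note R = psd_sqrt[OF S, folded R_def]
  have Rsq: "a * (x \<bullet> x) \<le> (vnorm (R *\<^sub>v x))\<^sup>2" if "x \<in> carrier_vec n" for x
    using lo[OF that] vnorm_psd_sqrt_sq[OF S that] by (simp add: R_def)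
  have Rinj: "x = 0\<^sub>v n" if x: "x \<in> carrier_vec n" and "R *\<^sub>v x = 0\<^sub>v n" for x
  proof -
    have "a * (x \<bullet> x) \<le> 0" using Rsq[OF x] that by simp
    then have "x \<bullet> x = 0" using a sprod_self_nonneg[of x] by (simp add: mult_le_0_iff)
    then show ?thesis using sprod_self_eq_0[OF x] by simp
  qed
  have B_eq: "B = inv_mat R" by (simp add: B_def R_def inv_sqrt_def)
  note B = inv_mat[OF R(1) Rinj, folded B_eq]
  show "inv_sqrt S \<in> carrier_mat n n" "psd_sqrt S * inv_sqrt S = 1\<^sub>m n" "inv_sqrt S * psd_sqrt S = 1\<^sub>m n"
    using B by (auto simp: B_def R_def)
  have Sinj: "x = 0\<^sub>v n" if x: "x \<in> carrier_vec n" and 0: "S *\<^sub>v x = 0\<^sub>v n" for x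
  proof -
    have "R *\<^sub>v (R *\<^sub>v x) = 0\<^sub>v n" using R x 0 by (metis assoc_mult_mat_vec)
    then show ?thesis using Rinj[OF x] Rinj[of "R *\<^sub>v x"] R x by simp
  qed
  note Si = inv_mat[OF S(1) Sinj]
  have "(B * B) * S = B * (B * R) * R" unfolding R(3)[symmetric] using B(1) R(1)
    by (simp add: assoc_mult_mat[of _ n n _ n _ n])
  then have BBS: "(B * B) * S = 1\<^sub>m n" using B by simp
  have "B * B = (B * B) * (S * inv_mat S)" using B(1) Si by simp
  also have "\<dots> = ((B * B) * S) * inv_mat S" using B(1) Si(1) S
    by (intro assoc_mult_mat[symmetric, of _ n n _ n _ n]) auto
  finally show "inv_sqrt S * inv_sqrt S = inv_mat S" using Si(1) BBS by (simp add: B_def)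
  show "opnorm_le (inv_sqrt S) (1 / sqrt a)" unfolding B_def[symmetric]
  proof (rule opnorm_leI[OF _ B(1)])
    fix x :: "real vec" assume x: "x \<in> carrier_vec n"
    define y where "y = B *\<^sub>v x"
    have y: "y \<in> carrier_vec n" using B x by (simp add: y_def)
    have "R *\<^sub>v y = x" unfolding y_def using B R x by (metis assoc_mult_mat_vec one_mult_mat_vec)
    then have "a * (vnorm y)\<^sup>2 \<le> (vnorm x)\<^sup>2" using Rsq[OF y] by (simp add: vnorm_sq)
    then have "(sqrt a * vnorm y)\<^sup>2 \<le> (vnorm x)\<^sup>2" using a by (simp add: power_mult_distrib)
    then have "sqrt a * vnorm y \<le> vnorm x" by (rule power2_le_imp_le) simp
    then show "vnorm (B *\<^sub>v x) \<le> 1 / sqrt a * vnorm x" using a by (simp add: y_def field_simps)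
  qed (use a in simp)
qed

text \<open>Let \<open>R\<close> be the square root of \<open>S\<close> and \<open>A = R\<^sup>-\<^sup>1 T R\<^sup>-\<^sup>1\<close>. Since \<open>R\<^sup>-\<^sup>1\<close> has norm at most
  \<open>a\<^bsup>-1/2\<^esup>\<close>, the spectral norm of \<open>A\<close> is at most \<open>L / a\<close>. Since \<open>T = R A R\<close> and \<open>R\<close> has norm at most
  \<open>K\<^bsup>1/2\<^esup>\<close>, the Frobenius norm of \<open>A\<close> is at least that of \<open>T\<close> divided by \<open>K\<close>. So whitening by \<open>S\<close>
  costs no more than the bound \<open>K / a\<close> on the condition number of \<open>S\<close>. The bound \<open>C\<close> on the ratio for
  \<open>T\<close> is stated with an arbitrary bound \<open>L\<close> in place of the spectral norm of \<open>T\<close>.\<close>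

lemma norm_ratio_whitened_le:
  assumes S: "S \<in> carrier_mat n n" "psd S"
    and lo: "\<And>x. x \<in> carrier_vec n \<Longrightarrow> a * (x \<bullet> x) \<le> x \<bullet> (S *\<^sub>v x)" and a: "0 < a"
    and hi: "opnorm_le S K"
    and T: "T \<in> carrier_mat n n" "opnorm_le T L"
    and pos: "0 < frobenius_norm T" and LC: "L \<le> C * frobenius_norm T"
  shows "norm_ratio (inv_sqrt S * T * inv_sqrt S) \<le> K / a * C"
proof -
  define R B where "R = psd_sqrt S" and "B = inv_sqrt S"
  note R = psd_sqrt[OF S, folded R_def]
  note B = inv_sqrt_posdef[OF S lo a, folded R_def B_def]
  have K0: "0 \<le> K" using hi by (rule opnorm_le_nonneg)
  have Rop: "opnorm_le R (sqrt K)"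
  proof (rule opnorm_leI[OF _ R(1)])
    fix x :: "real vec" assume x: "x \<in> carrier_vec n"
    have "(vnorm (R *\<^sub>v x))\<^sup>2 \<le> vnorm x * vnorm (S *\<^sub>v x)"
      unfolding R_def vnorm_psd_sqrt_sq[OF S x] using abs_sprod_le[of x n "S *\<^sub>v x"] S x by simp
    also have "\<dots> \<le> vnorm x * (K * vnorm x)"
      by (intro mult_left_mono opnorm_leD[OF hi S(1) x]) simp
    also have "\<dots> = (sqrt K * vnorm x)\<^sup>2" using K0 by (simp add: power2_eq_square algebra_simps)
    finally show "vnorm (R *\<^sub>v x) \<le> sqrt K * vnorm x"
      by (rule power2_le_imp_le) (simp add: K0)
  qed (simp add: K0)
  define A where "A = B * T * B"
  have A: "A \<in> carrier_mat n n" using B(1) T by (simp add: A_def)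
  have "opnorm_le A (1 / sqrt a * L * (1 / sqrt a))" unfolding A_def
    by (intro opnorm_le_mult[of _ n n _ _ n] mult_carrier_mat[of _ n n] B T)
  then have up: "spectral_norm A \<le> L / a" using spectral_norm_le[of A] a by fastforce
  have "R * A * R = (R * B) * T * (B * R)"
    unfolding A_def using B(1) R(1) T(1) by (simp add: assoc_mult_mat[of _ n n _ n _ n])
  then have TR: "T = R * A * R" using B(2,3) T(1) by simp
  have "frobenius_norm T \<le> sqrt K * frobenius_norm (R * A)"
    unfolding TR using R(1) A by (intro frobenius_mult_le_right[OF R(1) Rop, of _ n]) simp
  also have "\<dots> \<le> sqrt K * (sqrt K * frobenius_norm A)"
    by (intro mult_left_mono frobenius_mult_le_left[OF R(1) Rop A]) (simp add: K0)
  finally have fT: "frobenius_norm T \<le> K * frobenius_norm A" using K0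
    by (simp add: mult.assoc[symmetric])
  have fA: "0 < frobenius_norm A"
  proof (rule ccontr)
    assume "\<not> ?thesis"
    then have "frobenius_norm A = 0" using frobenius_norm_nonneg[of A] by linarith
    then show False using fT pos by simp
  qed
  have "0 \<le> C * frobenius_norm T" using LC opnorm_le_nonneg[OF T(2)] by linarith
  then have C0: "0 \<le> C" using pos by (simp add: zero_le_mult_iff)
  have "L \<le> C * (K * frobenius_norm A)" using LC mult_left_mono[OF fT C0] by linarith
  then have "spectral_norm A \<le> C * (K * frobenius_norm A) / a"
    using a by (intro order_trans[OF up] divide_right_mono) auto
  then have "spectral_norm A / frobenius_norm A \<le> K / a * C"
    using fA by (simp add: divide_le_eq algebra_simps)
  then show ?thesis
    using fA unfolding A_def B_def norm_ratio_def by simp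
qed

section \<open>Orthogonal projections and lower bounds for Frobenius norms\<close>

definition mat_trace :: "real mat \<Rightarrow> real" where
  "mat_trace A = (\<Sum>i<dim_row A. A $$ (i, i))"

lemma mat_trace_mult_comm:
  assumes "A \<in> carrier_mat n k" "B \<in> carrier_mat k n"
  shows "mat_trace (A * B) = mat_trace (B * A)"
proof -
  have "mat_trace (A * B) = (\<Sum>i<n. \<Sum>j<k. A $$ (i, j) * B $$ (j, i))"
    using assms by (auto simp: mat_trace_def scalar_prod_def atLeast0LessThan intro!: sum.cong)
  also have "\<dots> = (\<Sum>j<k. \<Sum>i<n. B $$ (j, i) * A $$ (i, j))"
    by (subst sum.swap) (simp add: mult.commute)
  also have "\<dots> = mat_trace (B * A)"
    using assms by (auto simp: mat_trace_def scalar_prod_def atLeast0LessThan intro!: sum.cong)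
  finally show ?thesis .
qed

lemma mat_trace_one [simp]: "mat_trace (1\<^sub>m n) = n"
  by (simp add: mat_trace_def)

lemma mat_trace_minus:
  "A \<in> carrier_mat n n \<Longrightarrow> B \<in> carrier_mat n n \<Longrightarrow> mat_trace (A - B) = mat_trace A - mat_trace B"
  by (auto simp: mat_trace_def sum_subtractf)

definition orth_proj :: "nat \<Rightarrow> real mat \<Rightarrow> bool" where
  "orth_proj n P \<longleftrightarrow> P \<in> carrier_mat n n \<and> P\<^sup>T = P \<and> P * P = P"

lemma orth_proj_complement:
  assumes "orth_proj n P"
  shows "orth_proj n (1\<^sub>m n - P)"
proof -
  have P: "P \<in> carrier_mat n n" "P\<^sup>T = P" "P * P = P" using assms by (auto simp: orth_proj_def)
  have "(1\<^sub>m n - P)\<^sup>T = 1\<^sub>m n - P"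
    using transpose_minus[of "1\<^sub>m n" n n P] P by simp
  moreover have "(1\<^sub>m n - P) * (1\<^sub>m n - P) = 1\<^sub>m n - P"
  proof -
    have "(1\<^sub>m n - P) * (1\<^sub>m n - P) = (1\<^sub>m n - P) - (P - P * P)"
      using P(1) minus_mult_distrib_mat[OF one_carrier_mat P(1) minus_carrier_mat[OF P(1)], of "1\<^sub>m n"]
        mult_minus_distrib_mat[OF P(1) one_carrier_mat P(1)]
      by (simp add: minus_carrier_mat)
    also have "\<dots> = 1\<^sub>m n - P" using P by (intro eq_matI) auto
    finally show ?thesis .
  qed
  ultimately show ?thesis using P by (simp add: orth_proj_def minus_carrier_mat)
qed

lemma opnorm_le_orth_proj:
  assumes "orth_proj n P"
  shows "opnorm_le P 1"
proof -
  have P: "P \<in> carrier_mat n n" "P\<^sup>T = P" "P * P = P" using assms by (auto simp: orth_proj_def)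
  show ?thesis
  proof (rule opnorm_leI[OF _ P(1)])
    fix x :: "real vec" assume x: "x \<in> carrier_vec n"
    have "P *\<^sub>v (P *\<^sub>v x) = P *\<^sub>v x" using P x by (metis assoc_mult_mat_vec)
    then have "(vnorm (P *\<^sub>v x))\<^sup>2 = x \<bullet> (P *\<^sub>v x)"
      unfolding vnorm_sq using transpose_vec_mult_scalar[of P n n "P *\<^sub>v x" x] P x by simp
    also have "\<dots> \<le> vnorm x * vnorm (P *\<^sub>v x)" using abs_sprod_le[of x n "P *\<^sub>v x"] P x by simp
    finally show "vnorm (P *\<^sub>v x) \<le> 1 * vnorm x"
      using vnorm_nonneg[of "P *\<^sub>v x"] vnorm_nonneg[of x]
      by (cases "vnorm (P *\<^sub>v x) = 0") (auto simp: power2_eq_square)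
  qed simp
qed

text \<open>The trace turns the Frobenius norm of a projection into its rank, and the invariance of the trace
  under \<open>A B \<mapsto> B A\<close> computes that rank without any dimension theory.\<close>

lemma frobenius_orth_proj:
  assumes "orth_proj n P"
  shows "frobenius_norm P = sqrt (mat_trace P)"
proof -
  have P: "P \<in> carrier_mat n n" "P\<^sup>T = P" "P * P = P" using assms by (auto simp: orth_proj_def)
  have "(frobenius_norm P)\<^sup>2 = mat_trace (P\<^sup>T * P)"
    unfolding frobenius_norm_sq_cols[OF P(1)] vnorm_sq mat_trace_def using P(1) by simp
  then show ?thesis unfolding P by (metis frobenius_norm_nonneg real_sqrt_unique)
qed

text \<open>With \<open>Q = V V\<^sup>T\<close> and \<open>P = I - Q\<close>, the part of \<open>M = Q M Q + Q M P + P M\<close> that the compression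
  loses consists of two terms with a factor \<open>P\<close>. As \<open>P\<close> is a projection of rank \<open>n - k\<close>, each of
  them has Frobenius norm at most \<open>sqrt (n - k)\<close> times a bound on the spectral norm of \<open>M\<close>.\<close>

lemma frobenius_compression:
  assumes V: "V \<in> carrier_mat n k" "V\<^sup>T * V = 1\<^sub>m k" and kn: "k \<le> n"
    and M: "M \<in> carrier_mat n n" "opnorm_le M L"
  shows "frobenius_norm M \<le> frobenius_norm (V\<^sup>T * M * V) + 2 * sqrt (real (n - k)) * L"
proof -
  define Q P where "Q = V * V\<^sup>T" and "P = 1\<^sub>m n - Q"
  have VT: "V\<^sup>T \<in> carrier_mat k n" using V by simp
  have Q: "Q \<in> carrier_mat n n" using V by (simp add: Q_def)
  have "Q * Q = V * (V\<^sup>T * V) * V\<^sup>T" unfolding Q_def using V(1) VT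
    by (simp add: assoc_mult_mat[of _ n k _ n _ n] assoc_mult_mat[of _ n k _ k _ n] assoc_mult_mat[of _ k n _ k _ n])
  then have "Q * Q = Q" using V by (simp add: Q_def)
  moreover have "Q\<^sup>T = Q" using V by (simp add: Q_def transpose_mult[of _ n k _ n])
  ultimately have Qp: "orth_proj n Q" using Q by (simp add: orth_proj_def)
  then have Pp: "orth_proj n P" unfolding P_def by (rule orth_proj_complement)
  have P: "P \<in> carrier_mat n n" using Pp by (simp add: orth_proj_def)
  have "mat_trace Q = k" unfolding Q_def using mat_trace_mult_comm[OF V(1) VT] V(2) by simp
  then have "mat_trace P = real (n - k)" using Q kn by (simp add: P_def mat_trace_minus[of _ n])
  then have fP: "frobenius_norm P = sqrt (real (n - k))" using frobenius_orth_proj[OF Pp] by simp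
  have Vop: "opnorm_le V 1" by (rule opnorm_le_isometry[OF V])
  define T where "T = V\<^sup>T * M * V"
  have T: "T \<in> carrier_mat k k" using V M by (simp add: T_def)
  have QMQ: "V * T * V\<^sup>T = Q * M * Q"
    unfolding T_def Q_def using V(1) VT M(1)
    by (simp add: assoc_mult_mat[of _ n k _ n _ n] assoc_mult_mat[of _ n k _ k _ n]
      assoc_mult_mat[of _ k n _ k _ n] assoc_mult_mat[of _ k n _ n _ n] assoc_mult_mat[of _ k n _ n _ k]
      assoc_mult_mat[of _ n n _ n _ n] assoc_mult_mat[of _ n n _ k _ n])
  have "Q * M * Q + Q * M * P + P * M = Q * M * (Q + P) + P * M"
    using Q P M by (simp add: mult_add_distrib_mat[of _ n n _ n])
  also have "Q + P = 1\<^sub>m n" using Q by (intro eq_matI) (auto simp: P_def)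
  also have "Q * M * 1\<^sub>m n + P * M = (Q + P) * M"
    using Q P M by (simp add: add_mult_distrib_mat[of _ n n])
  also have "Q + P = 1\<^sub>m n" using Q by (intro eq_matI) (auto simp: P_def)
  finally have Meq: "M = V * T * V\<^sup>T + Q * M * P + P * M" using M by (simp add: QMQ)
  have "frobenius_norm M \<le> frobenius_norm (V * T * V\<^sup>T + Q * M * P) + frobenius_norm (P * M)"
    by (subst Meq, rule frobenius_norm_add_le[of _ n n]) (use V T Q M P in auto)
  also have "frobenius_norm (V * T * V\<^sup>T + Q * M * P) \<le> frobenius_norm (V * T * V\<^sup>T) + frobenius_norm (Q * M * P)"
    by (rule frobenius_norm_add_le[of _ n n]) (use V T Q M P in auto)
  also have "frobenius_norm (V * T * V\<^sup>T) \<le> 1 * frobenius_norm (V * T)"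
    using V T by (intro frobenius_mult_le_right[OF VT] opnorm_le_transpose[OF V(1)] Vop) auto
  also have "frobenius_norm (V * T) \<le> 1 * frobenius_norm T"
    by (rule frobenius_mult_le_left[OF V(1) Vop T])
  also have "frobenius_norm (Q * M * P) \<le> (1 * L) * frobenius_norm P"
    by (rule frobenius_mult_le_left[OF mult_carrier_mat[OF Q M(1)] opnorm_le_mult[OF Q _ M] P])
      (rule opnorm_le_orth_proj[OF Qp])
  also have "frobenius_norm (P * M) \<le> L * frobenius_norm P"
    by (rule frobenius_mult_le_right[OF M P])
  finally show ?thesis by (simp add: fP T_def algebra_simps)
qed

text \<open>Let \<open>P\<close> be the orthogonal projection onto the column space of \<open>Z\<close>, of rank \<open>k\<close>, and \<open>Q = I - P\<close>.
  The first bound holds because \<open>Q M = s Q\<close> and \<open>Q\<close> has rank \<open>n - k\<close>. For the second,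
  \<open>P M = Z C Z\<^sup>T + s P\<close>: projecting first means that removing the scalar part costs only
  \<open>\<bar>s\<bar> sqrt k\<close> rather than \<open>\<bar>s\<bar> sqrt n\<close>, which would be useless when \<open>n\<close> is much larger than \<open>k\<close>.
  Finally \<open>Z\<close> has a left inverse of norm at most \<open>a\<^bsup>-1/2\<^esup>\<close>, which recovers \<open>C\<close> from \<open>Z C Z\<^sup>T\<close>.\<close>

lemma frobenius_sandwich_plus_scalar:
  assumes Z: "Z \<in> carrier_mat n k" and kn: "k \<le> n" and a: "0 < a"
    and lo: "\<And>y. y \<in> carrier_vec k \<Longrightarrow> a * (y \<bullet> y) \<le> (Z *\<^sub>v y) \<bullet> (Z *\<^sub>v y)"
    and C: "C \<in> carrier_mat k k"
    and M_eq: "M = Z * C * Z\<^sup>T + s \<cdot>\<^sub>m 1\<^sub>m n"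
  shows "\<bar>s\<bar> * sqrt (real (n - k)) \<le> frobenius_norm M"
    and "a * frobenius_norm C \<le> frobenius_norm M + \<bar>s\<bar> * sqrt (real k)"
proof -
  have ZT: "Z\<^sup>T \<in> carrier_mat k n" using Z by simp
  define N where "N = Z\<^sup>T * Z"
  have N: "N \<in> carrier_mat k k" using Z by (simp add: N_def)
  have NT: "N\<^sup>T = N" using Z by (simp add: N_def transpose_mult[of _ k n _ k])
  have Ninj: "x = 0\<^sub>v k" if x: "x \<in> carrier_vec k" and 0: "N *\<^sub>v x = 0\<^sub>v k" for x
  proof -
    have "(Z *\<^sub>v x) \<bullet> (Z *\<^sub>v x) = (Z\<^sup>T *\<^sub>v (Z *\<^sub>v x)) \<bullet> x"
      using transpose_vec_mult_scalar[OF Z x, of "Z *\<^sub>v x"] Z x by simp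
    also have "Z\<^sup>T *\<^sub>v (Z *\<^sub>v x) = 0\<^sub>v k" using 0 Z ZT x by (metis N_def assoc_mult_mat_vec)
    finally have "a * (x \<bullet> x) \<le> 0" using lo[OF x] x by simp
    then have "x \<bullet> x = 0" using a sprod_self_nonneg[of x] by (simp add: mult_le_0_iff)
    then show ?thesis using sprod_self_eq_0[OF x] by simp
  qed
  note Ni = inv_mat[OF N Ninj]
  define B where "B = inv_mat N"
  note B = Ni[folded B_def]
  have BT: "B\<^sup>T = B"
  proof -
    have NBT: "N * B\<^sup>T = 1\<^sub>m k" using arg_cong[OF B(3), of transpose_mat] B(1) N NT
      by (simp add: transpose_mult[of _ k k _ k])
    have "B\<^sup>T = (B * N) * B\<^sup>T" using B by simp
    also have "\<dots> = B * (N * B\<^sup>T)" using B(1) N by (intro assoc_mult_mat[of _ k k _ k _ k]) auto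
    finally show ?thesis using NBT B(1) by simp
  qed
  \<comment> \<open>\<open>W = (Z\<^sup>T Z)\<^sup>-\<^sup>1 Z\<^sup>T\<close> is a left inverse of \<open>Z\<close>, and \<open>Z W\<close> is the projection onto its column space.\<close>
  define W where "W = B * Z\<^sup>T"
  have W: "W \<in> carrier_mat k n" using B(1) Z by (simp add: W_def)
  have WZ: "W * Z = 1\<^sub>m k"
    unfolding W_def using assoc_mult_mat[OF B(1) ZT Z] B(3) by (simp add: N_def)
  define P Q where "P = Z * W" and "Q = 1\<^sub>m n - P"
  have P: "P \<in> carrier_mat n n" using Z W by (simp add: P_def)
  have "P\<^sup>T = W\<^sup>T * Z\<^sup>T" unfolding P_def by (rule transpose_mult[OF Z W])
  also have "W\<^sup>T = Z * B" unfolding W_def using transpose_mult[OF B(1) ZT] BT by simp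
  also have "Z * B * Z\<^sup>T = P" unfolding P_def W_def by (rule assoc_mult_mat[OF Z B(1) ZT])
  finally have PT: "P\<^sup>T = P" .
  have PZ: "P * Z = Z" unfolding P_def using assoc_mult_mat[OF Z W Z] WZ Z by simp
  have PP: "P * P = P" using assoc_mult_mat[OF P Z W] PZ by (simp add: P_def)
  have Pp: "orth_proj n P" using P PT PP by (simp add: orth_proj_def)
  then have Qp: "orth_proj n Q" unfolding Q_def by (rule orth_proj_complement)
  have Q: "Q \<in> carrier_mat n n" using Qp by (simp add: orth_proj_def)
  have trP: "mat_trace P = k" unfolding P_def using mat_trace_mult_comm[OF Z W] WZ by simp
  then have "mat_trace Q = real (n - k)" using P kn by (simp add: Q_def mat_trace_minus[of _ n])
  then have fQ: "frobenius_norm Q = sqrt (real (n - k))" using frobenius_orth_proj[OF Qp] by simp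
  have fP: "frobenius_norm P = sqrt (real k)" using frobenius_orth_proj[OF Pp] trP by simp
  define G where "G = Z * C * Z\<^sup>T"
  have G: "G \<in> carrier_mat n n" using Z C by (simp add: G_def)
  have M: "M = G + s \<cdot>\<^sub>m 1\<^sub>m n" "M \<in> carrier_mat n n" using G M_eq by (auto simp: G_def)
  have PG: "P * G = G"
  proof -
    have "P * G = P * (Z * (C * Z\<^sup>T))" unfolding G_def using assoc_mult_mat[OF Z C ZT] by simp
    also have "\<dots> = (P * Z) * (C * Z\<^sup>T)" using assoc_mult_mat[OF P Z, of "C * Z\<^sup>T" n] C ZT by simp
    also have "\<dots> = G" unfolding PZ G_def using assoc_mult_mat[OF Z C ZT] by simp
    finally show ?thesis .
  qed
  have PM: "P * M = G + s \<cdot>\<^sub>m P"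
    unfolding M(1) using P G PG by (simp add: mult_add_distrib_mat[of _ n n] mult_smult_distrib[of _ n n _ n])
  have QM: "Q * M = s \<cdot>\<^sub>m Q"
  proof -
    have "Q * M = M - P * M" unfolding Q_def using P M(2) by (simp add: minus_mult_distrib_mat[of _ n n])
    also have "\<dots> = s \<cdot>\<^sub>m Q" unfolding PM unfolding M(1) using P G by (intro eq_matI) (auto simp: Q_def algebra_simps)
    finally show ?thesis .
  qed
  have "frobenius_norm (Q * M) \<le> 1 * frobenius_norm M"
    by (rule frobenius_mult_le_left[OF Q opnorm_le_orth_proj[OF Qp] M(2)])
  then show "\<bar>s\<bar> * sqrt (real (n - k)) \<le> frobenius_norm M"
    unfolding QM frobenius_norm_smult fQ by simp
  have "G = P * M + (- s) \<cdot>\<^sub>m P" unfolding PM using P G by (intro eq_matI) auto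
  then have "frobenius_norm G \<le> frobenius_norm (P * M) + frobenius_norm ((- s) \<cdot>\<^sub>m P)"
    using frobenius_norm_add_le[of "P * M" n n "(- s) \<cdot>\<^sub>m P"] P M(2) by simp
  also have "frobenius_norm (P * M) \<le> 1 * frobenius_norm M"
    by (rule frobenius_mult_le_left[OF P opnorm_le_orth_proj[OF Pp] M(2)])
  finally have G_le: "frobenius_norm G \<le> frobenius_norm M + \<bar>s\<bar> * sqrt (real k)"
    unfolding frobenius_norm_smult fP by simp
  have Wop: "opnorm_le W (1 / sqrt a)"
  proof (rule opnorm_leI[OF _ W])
    fix x :: "real vec" assume x: "x \<in> carrier_vec n"
    define y where "y = W *\<^sub>v x"
    have y: "y \<in> carrier_vec k" using W x by (simp add: y_def)
    have "Z *\<^sub>v y = P *\<^sub>v x" unfolding y_def P_def using assoc_mult_mat_vec[OF Z W x] by simp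
    then have "(sqrt a * vnorm y)\<^sup>2 \<le> (vnorm (P *\<^sub>v x))\<^sup>2"
      using lo[OF y] a by (simp add: power_mult_distrib vnorm_sq)
    then have "sqrt a * vnorm y \<le> vnorm (P *\<^sub>v x)" by (rule power2_le_imp_le) simp
    also have "\<dots> \<le> 1 * vnorm x" by (rule opnorm_leD[OF opnorm_le_orth_proj[OF Pp] P x])
    finally show "vnorm (W *\<^sub>v x) \<le> 1 / sqrt a * vnorm x" using a by (simp add: y_def field_simps)
  qed (use a in simp)
  have WT: "W\<^sup>T \<in> carrier_mat n k" using W by simp
  have ZW: "Z\<^sup>T * W\<^sup>T = 1\<^sub>m k" using transpose_mult[OF W Z] WZ by simp
  have "W * G = (W * Z) * (C * Z\<^sup>T)"
    unfolding G_def using assoc_mult_mat[OF Z C ZT] assoc_mult_mat[OF W Z, of "C * Z\<^sup>T" n] C ZT by simp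
  then have WG: "W * G = C * Z\<^sup>T" unfolding WZ using C ZT by simp
  have "C = W * G * W\<^sup>T" unfolding WG using assoc_mult_mat[OF C ZT WT] ZW C by simp
  then have "frobenius_norm C \<le> 1 / sqrt a * frobenius_norm (W * G)"
    using frobenius_mult_le_right[OF WT opnorm_le_transpose[OF W Wop], of "W * G" k] W G by simp
  also have "\<dots> \<le> 1 / sqrt a * (1 / sqrt a * frobenius_norm G)"
    by (intro mult_left_mono frobenius_mult_le_left[OF W Wop G]) (use a in simp)
  finally have "a * frobenius_norm C \<le> frobenius_norm G" using a by (simp add: field_simps)
  then show "a * frobenius_norm C \<le> frobenius_norm M + \<bar>s\<bar> * sqrt (real k)" using G_le by simp
qed

section \<open>Block-diagonal matrices\<close>

lemma diag_block_mat_Cons_carrier: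
  "A \<in> carrier_mat r c \<Longrightarrow> diag_block_mat As \<in> carrier_mat r' c' \<Longrightarrow>
   diag_block_mat (A # As) = four_block_mat A (0\<^sub>m r c') (0\<^sub>m r' c) (diag_block_mat As)"
  by (auto simp: Let_def)

lemma four_block_diag_mult_vec:
  assumes "A \<in> carrier_mat r c" "B \<in> carrier_mat r' c'" "x \<in> carrier_vec c" "y \<in> carrier_vec c'"
  shows "four_block_mat A (0\<^sub>m r c') (0\<^sub>m r' c) B *\<^sub>v (x @\<^sub>v y) = (A *\<^sub>v x) @\<^sub>v (B *\<^sub>v y :: real vec)"
proof -
  have "0\<^sub>m r c' *\<^sub>v y = 0\<^sub>v r" "0\<^sub>m r' c *\<^sub>v x = 0\<^sub>v r'" using assms by (auto intro!: eq_vecI)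
  then show ?thesis
    using assms by (subst four_block_mat_mult_vec[OF assms(1) zero_carrier_mat zero_carrier_mat assms(2,3,4)]) simp
qed

lemma diag_block_mat_norm_bounds:
  assumes "\<And>A y. A \<in> set As \<Longrightarrow> y \<in> carrier_vec (dim_col A) \<Longrightarrow>
      lo * (y \<bullet> y) \<le> (A *\<^sub>v y) \<bullet> (A *\<^sub>v y) \<and> (A *\<^sub>v y) \<bullet> (A *\<^sub>v y) \<le> hi * (y \<bullet> (y :: real vec))"
    and "y \<in> carrier_vec (dim_col (diag_block_mat As))"
  shows "lo * (y \<bullet> y) \<le> (diag_block_mat As *\<^sub>v y) \<bullet> (diag_block_mat As *\<^sub>v y) \<and>
    (diag_block_mat As *\<^sub>v y) \<bullet> (diag_block_mat As *\<^sub>v y) \<le> hi * (y \<bullet> y)"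
  using assms
proof (induction As arbitrary: y)
  case Nil
  then show ?case by (simp add: scalar_prod_def)
next
  case (Cons A As)
  define D where "D = diag_block_mat As"
  define u w where "u = vec_first y (dim_col A)" and "w = vec_last y (dim_col D)"
  have A: "A \<in> carrier_mat (dim_row A) (dim_col A)" and D: "D \<in> carrier_mat (dim_row D) (dim_col D)" by auto
  have "y \<in> carrier_vec (dim_col A + dim_col D)" using Cons.prems(2) by (simp add: D_def Let_def)
  then have y: "y = u @\<^sub>v w" by (simp add: u_def w_def)
  have u: "u \<in> carrier_vec (dim_col A)" and w: "w \<in> carrier_vec (dim_col D)" by (auto simp: u_def w_def)
  have mult: "diag_block_mat (A # As) *\<^sub>v y = (A *\<^sub>v u) @\<^sub>v (D *\<^sub>v w)"
    unfolding y diag_block_mat_Cons_carrier[OF A D[unfolded D_def]]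
    using four_block_diag_mult_vec[OF A D u w] by (simp add: D_def)
  have "lo * (u \<bullet> u) \<le> (A *\<^sub>v u) \<bullet> (A *\<^sub>v u) \<and> (A *\<^sub>v u) \<bullet> (A *\<^sub>v u) \<le> hi * (u \<bullet> u)"
    using Cons.prems(1)[of A u] u by simp
  moreover have "lo * (w \<bullet> w) \<le> (D *\<^sub>v w) \<bullet> (D *\<^sub>v w) \<and> (D *\<^sub>v w) \<bullet> (D *\<^sub>v w) \<le> hi * (w \<bullet> w)"
    unfolding D_def using Cons.prems(1) w by (intro Cons.IH) (auto simp: D_def)
  moreover have "y \<bullet> y = u \<bullet> u + w \<bullet> w" unfolding y by (rule scalar_prod_append[OF u w u w])
  moreover have "(diag_block_mat (A # As) *\<^sub>v y) \<bullet> (diag_block_mat (A # As) *\<^sub>v y)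
      = (A *\<^sub>v u) \<bullet> (A *\<^sub>v u) + (D *\<^sub>v w) \<bullet> (D *\<^sub>v w)"
    unfolding mult using A D u w
    by (intro scalar_prod_append[of _ "dim_row A" _ "dim_row D"] mult_mat_vec_carrier)
  ultimately show ?case by (simp add: algebra_simps)
qed

lemma diag_block_mat_quadratic_nonneg:
  assumes "\<And>A. A \<in> set As \<Longrightarrow> square_mat A"
    and "\<And>A y. A \<in> set As \<Longrightarrow> y \<in> carrier_vec (dim_col A) \<Longrightarrow> 0 \<le> y \<bullet> (A *\<^sub>v (y :: real vec))"
    and "y \<in> carrier_vec (dim_col (diag_block_mat As))"
  shows "0 \<le> y \<bullet> (diag_block_mat As *\<^sub>v y)"
  using assms
proof (induction As arbitrary: y)
  case Nil
  then show ?case by (simp add: scalar_prod_def)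
next
  case (Cons A As)
  define D where "D = diag_block_mat As"
  define u w where "u = vec_first y (dim_col A)" and "w = vec_last y (dim_col D)"
  have sq: "dim_row A = dim_col A" "dim_row D = dim_col D"
    using Cons.prems(1) diag_block_mat_square[of As] by (auto simp: D_def)
  have A: "A \<in> carrier_mat (dim_col A) (dim_col A)" and D: "D \<in> carrier_mat (dim_col D) (dim_col D)" using sq by auto
  have "y \<in> carrier_vec (dim_col A + dim_col D)" using Cons.prems(3) by (simp add: D_def Let_def)
  then have y: "y = u @\<^sub>v w" by (simp add: u_def w_def)
  have u: "u \<in> carrier_vec (dim_col A)" and w: "w \<in> carrier_vec (dim_col D)" by (auto simp: u_def w_def)
  have mult: "diag_block_mat (A # As) *\<^sub>v y = (A *\<^sub>v u) @\<^sub>v (D *\<^sub>v w)"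
    unfolding y diag_block_mat_Cons_carrier[OF A D[unfolded D_def]]
    using four_block_diag_mult_vec[OF A D u w] by (simp add: D_def)
  have "0 \<le> u \<bullet> (A *\<^sub>v u)" using Cons.prems(2)[of A u] u by simp
  moreover have "0 \<le> w \<bullet> (D *\<^sub>v w)"
    unfolding D_def using Cons.prems(1,2) w by (intro Cons.IH) (auto simp: D_def)
  moreover have "y \<bullet> (diag_block_mat (A # As) *\<^sub>v y) = u \<bullet> (A *\<^sub>v u) + w \<bullet> (D *\<^sub>v w)"
    unfolding mult using A D u w scalar_prod_append[of u "dim_col A" w "dim_col D" "A *\<^sub>v u" "D *\<^sub>v w"]
    by (metis y mult_mat_vec_carrier)
  ultimately show ?case by simp
qed

lemma sum_lessThan_add: "(\<Sum>i<a + b. f i) = (\<Sum>i<a. f i) + (\<Sum>i<b. f (a + i :: nat))" for f :: "nat \<Rightarrow> real"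
  by (induction b) (auto simp: add.assoc)

lemma frobenius_diag_block_mat_sq:
  "(frobenius_norm (diag_block_mat As))\<^sup>2 = (\<Sum>A\<leftarrow>As. (frobenius_norm A)\<^sup>2)"
proof (induction As)
  case Nil
  show ?case by (subst frobenius_norm_sq[of _ 0 0]) auto
next
  case (Cons A As)
  define D where "D = diag_block_mat As"
  obtain r c r' c' where A: "A \<in> carrier_mat r c" and D: "D \<in> carrier_mat r' c'" by blast
  define F where "F = four_block_mat A (0\<^sub>m r c') (0\<^sub>m r' c) D"
  have F: "F \<in> carrier_mat (r + r') (c + c')" using A D by (simp add: F_def)
  have "(frobenius_norm F)\<^sup>2 = (frobenius_norm A)\<^sup>2 + (frobenius_norm D)\<^sup>2"
    unfolding frobenius_norm_sq[OF A] frobenius_norm_sq[OF D] frobenius_norm_sq[OF F] sum_lessThan_add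
    using A D by (intro arg_cong2[of _ _ _ _ "(+)"] sum.cong) (auto simp: F_def)
  moreover have "diag_block_mat (A # As) = F"
    using diag_block_mat_Cons_carrier[OF A D[unfolded D_def]] by (simp add: F_def D_def)
  ultimately show ?case using Cons by (simp add: D_def)
qed

lemma kronecker_one_carrier:
  "B \<in> carrier_mat q q \<Longrightarrow> kronecker (1\<^sub>m m) B \<in> carrier_mat (m * q) (m * q)"
  by (simp add: kronecker_def)

lemma kronecker_one_index:
  assumes "B \<in> carrier_mat q q" "i < m * q" "j < m * q"
  shows "kronecker (1\<^sub>m m) B $$ (i, j) = (if i div q = j div q then B $$ (i mod q, j mod q) else 0)"
  using assms by (auto simp: kronecker_def less_mult_imp_div_less)

text \<open>The Kronecker product is given by index arithmetic with \<open>div\<close> and \<open>mod\<close>; as a block-diagonal matrix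
  it is accessible to the same list inductions as the design matrix \<open>Z\<close>.\<close>

lemma kronecker_one_eq_diag_block_mat:
  assumes B: "B \<in> carrier_mat q q" and q: "q > 0"
  shows "kronecker (1\<^sub>m m) B = diag_block_mat (replicate m B)"
proof (induction m)
  case 0
  show ?case using B by (intro eq_matI) (auto simp: kronecker_def)
next
  case (Suc m)
  have K: "kronecker (1\<^sub>m m) B \<in> carrier_mat (m * q) (m * q)" by (rule kronecker_one_carrier[OF B])
  have "diag_block_mat (replicate (Suc m) B)
      = four_block_mat B (0\<^sub>m q (m * q)) (0\<^sub>m (m * q) q) (kronecker (1\<^sub>m m) B)"
    using diag_block_mat_Cons_carrier[OF B K[unfolded Suc]] by (simp add: Suc)
  moreover have "kronecker (1\<^sub>m (Suc m)) B = \<dots>"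
  proof (rule eq_matI)
    fix i j assume "i < dim_row (four_block_mat B (0\<^sub>m q (m * q)) (0\<^sub>m (m * q) q) (kronecker (1\<^sub>m m) B))"
      "j < dim_col (four_block_mat B (0\<^sub>m q (m * q)) (0\<^sub>m (m * q) q) (kronecker (1\<^sub>m m) B))"
    then have ij: "i < Suc m * q" "j < Suc m * q" using B K by auto
    have shift: "l div q = Suc ((l - q) div q)" "l mod q = (l - q) mod q" if "\<not> l < q" for l
      using that q by (auto simp: le_div_geq le_mod_geq)
    show "kronecker (1\<^sub>m (Suc m)) B $$ (i, j)
      = four_block_mat B (0\<^sub>m q (m * q)) (0\<^sub>m (m * q) q) (kronecker (1\<^sub>m m) B) $$ (i, j)"
      unfolding kronecker_one_index[OF B ij]
      using B K ij q shift[of i] shift[of j]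
      by (cases "i < q"; cases "j < q") (auto simp: kronecker_one_index[OF B])
  qed (use B K in \<open>auto simp: kronecker_def\<close>)
  ultimately show ?case by simp
qed

lemma frobenius_kronecker_one:
  assumes "B \<in> carrier_mat q q" "q > 0"
  shows "frobenius_norm (kronecker (1\<^sub>m m) B) = sqrt m * frobenius_norm B"
proof -
  have "(frobenius_norm (kronecker (1\<^sub>m m) B))\<^sup>2 = m * (frobenius_norm B)\<^sup>2"
    unfolding kronecker_one_eq_diag_block_mat[OF assms] frobenius_diag_block_mat_sq
    by (simp add: sum_list_replicate)
  then show ?thesis by (metis frobenius_norm_nonneg real_sqrt_mult real_sqrt_abs abs_of_nonneg)
qed

lemma opnorm_le_kronecker_one:
  assumes B: "B \<in> carrier_mat q q" "q > 0" and L: "opnorm_le B L"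
  shows "opnorm_le (kronecker (1\<^sub>m m) B) L"
proof (rule opnorm_leI[OF opnorm_le_nonneg[OF L] kronecker_one_carrier[OF B(1)]])
  fix x :: "real vec" assume x: "x \<in> carrier_vec (m * q)"
  \<comment> \<open>The lemma on block-diagonal matrices is two-sided; \<open>- 1\<close> is a lower bound that always holds.\<close>
  have "- 1 * (x \<bullet> x) \<le> (kronecker (1\<^sub>m m) B *\<^sub>v x) \<bullet> (kronecker (1\<^sub>m m) B *\<^sub>v x) \<and>
      (kronecker (1\<^sub>m m) B *\<^sub>v x) \<bullet> (kronecker (1\<^sub>m m) B *\<^sub>v x) \<le> L\<^sup>2 * (x \<bullet> x)"
    unfolding kronecker_one_eq_diag_block_mat[OF B]
  proof (rule diag_block_mat_norm_bounds)
    fix A :: "real mat" and y :: "real vec"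
    assume "A \<in> set (replicate m B)" and y: "y \<in> carrier_vec (dim_col A)"
    then have A: "A = B" by auto
    have "(vnorm (B *\<^sub>v y))\<^sup>2 \<le> (L * vnorm y)\<^sup>2"
      using opnorm_leD[OF L B(1)] y B A by (intro power_mono) auto
    moreover have "- 1 * (y \<bullet> y) \<le> (B *\<^sub>v y) \<bullet> (B *\<^sub>v y)"
      using sprod_self_nonneg[of y] sprod_self_nonneg[of "B *\<^sub>v y"] by linarith
    ultimately show "- 1 * (y \<bullet> y) \<le> (A *\<^sub>v y) \<bullet> (A *\<^sub>v y) \<and> (A *\<^sub>v y) \<bullet> (A *\<^sub>v y) \<le> L\<^sup>2 * (y \<bullet> y)"
      by (simp add: A power_mult_distrib vnorm_sq)
  qed (use x kronecker_one_carrier[OF B(1), of m] in \<open>simp add: kronecker_one_eq_diag_block_mat[OF B]\<close>)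
  then have "(vnorm (kronecker (1\<^sub>m m) B *\<^sub>v x))\<^sup>2 \<le> (L * vnorm x)\<^sup>2"
    by (simp add: vnorm_sq power_mult_distrib)
  then show "vnorm (kronecker (1\<^sub>m m) B *\<^sub>v x) \<le> L * vnorm x"
    by (rule power2_le_imp_le) (simp add: opnorm_le_nonneg[OF L])
qed

section \<open>Half-vectorization and the covariance of the random effects\<close>

lemma Psi1_spec:
  "Psi1 q v \<in> carrier_mat q q" "symmetric (Psi1 q v)" "vech (Psi1 q v) = cov_part q v"
  using theI'[OF ex1_Psi1[of q v], folded Psi1_def] by auto

lemma symmetric_index:
  "B \<in> carrier_mat q q \<Longrightarrow> symmetric B \<Longrightarrow> i < q \<Longrightarrow> j < q \<Longrightarrow> B $$ (i, j) = B $$ (j, i)"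
  using index_transpose_mat(1)[of j B i] by (auto simp: symmetric_def)

lemma vech_index:
  "B \<in> carrier_mat q q \<Longrightarrow> k < nparams q - 1 \<Longrightarrow> vech B $ k = B $$ (vech_pairs q ! k)"
  by (simp add: vech_def vec_of_list_index length_vech_pairs nparams_def)

text \<open>Each entry of \<open>\<Psi>\<^sub>1(v)\<close> is one fixed coordinate of \<open>v\<close>. Linearity of \<open>\<Psi>\<close> in \<open>v\<close> and its partial
  derivatives are read off from this.\<close>

lemma Psi1_coordinate:
  assumes "i < q" "j < q"
  obtains k where "k < nparams q - 1" "\<And>v. Psi1 q v $$ (i, j) = v $ k"
proof -
  have "(max i j, min i j) \<in> set (vech_pairs q)" using assms by (auto simp: set_vech_pairs)
  then obtain k where k: "k < nparams q - 1" "vech_pairs q ! k = (max i j, min i j)"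
    by (metis in_set_conv_nth length_vech_pairs nparams_def diff_add_inverse2)
  have "Psi1 q v $$ (i, j) = v $ k" for v
  proof -
    note P = Psi1_spec[of q v]
    have "Psi1 q v $$ (i, j) = Psi1 q v $$ (max i j, min i j)"
      using symmetric_index[OF P(1,2) assms] by (cases "i \<le> j") (auto simp: max_def min_def)
    also have "\<dots> = cov_part q v $ k" using vech_index[OF P(1) k(1)] k(2) P(3) by simp
    also have "\<dots> = v $ k" using k by (simp add: cov_part_def vec_first_def)
    finally show ?thesis .
  qed
  then show ?thesis using k that by blast
qed

lemma vnorm_vech_sq:
  assumes B: "B \<in> carrier_mat q q"
  shows "(vnorm (vech B))\<^sup>2 = (\<Sum>ij\<in>{(i, j). j \<le> i \<and> i < q}. (B $$ ij)\<^sup>2)"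
proof -
  have len: "length (vech_pairs q) = nparams q - 1" by (simp add: length_vech_pairs nparams_def)
  have "(vnorm (vech B))\<^sup>2 = (\<Sum>k<nparams q - 1. (vech B $ k)\<^sup>2)"
    using B unfolding vnorm_def L2_set_def by (simp add: sum_nonneg vech_def len)
  also have "\<dots> = (\<Sum>k<nparams q - 1. (B $$ (vech_pairs q ! k))\<^sup>2)"
    using vech_index[OF B] by (intro sum.cong) auto
  also have "\<dots> = (\<Sum>ij\<in>set (vech_pairs q). (B $$ ij)\<^sup>2)"
    unfolding sum.distinct_set_conv_list[OF distinct_vech_pairs] sum_list_sum_nth
    by (simp add: len atLeast0LessThan)
  finally show ?thesis by (simp add: set_vech_pairs)
qed

text \<open>Half-vectorization keeps the diagonal and one copy of each pair of off-diagonal entries, so the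
  squared Frobenius norm lies between once and twice the squared norm of the half-vectorization.\<close>

lemma vnorm_vech_frobenius:
  assumes B: "B \<in> carrier_mat q q" "symmetric B"
  shows "vnorm (vech B) \<le> frobenius_norm B" "frobenius_norm B \<le> sqrt 2 * vnorm (vech B)"
proof -
  define f where "f = (\<lambda>ij. (B $$ ij)\<^sup>2)"
  define lower upper where "lower = {(i, j). j \<le> i \<and> i < q}" and "upper = {(i, j). i \<le> j \<and> j < q}"
  have all: "{..<q} \<times> {..<q} = lower \<union> upper" by (auto simp: lower_def upper_def)
  have fin: "finite lower" "finite upper" by (metis all finite_Un finite_SigmaI finite_lessThan)+
  have F: "(frobenius_norm B)\<^sup>2 = sum f (lower \<union> upper)"
    unfolding frobenius_norm_sq[OF B(1)] all[symmetric] f_def by (simp add: sum.cartesian_product)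
  have V: "(vnorm (vech B))\<^sup>2 = sum f lower"
    unfolding vnorm_vech_sq[OF B(1)] f_def lower_def ..
  have "sum f upper = sum f lower"
    by (rule sum.reindex_bij_witness[of _ prod.swap prod.swap])
      (auto simp: lower_def upper_def f_def intro!: arg_cong[of _ _ "\<lambda>x. x\<^sup>2"] symmetric_index[OF B])
  moreover have "sum f (lower \<union> upper) \<le> sum f lower + sum f upper"
    using sum_Un[OF fin, of f] sum_nonneg[of "lower \<inter> upper" f] by (simp add: f_def)
  ultimately have "(frobenius_norm B)\<^sup>2 \<le> (sqrt 2 * vnorm (vech B))\<^sup>2"
    unfolding F by (simp add: power_mult_distrib V)
  then show "frobenius_norm B \<le> sqrt 2 * vnorm (vech B)" by (rule power2_le_imp_le) simp
  have "(vnorm (vech B))\<^sup>2 \<le> (frobenius_norm B)\<^sup>2"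
    unfolding V F by (rule sum_mono2) (use fin in \<open>auto simp: f_def\<close>)
  then show "vnorm (vech B) \<le> frobenius_norm B" by (rule power2_le_imp_le) simp
qed

text \<open>Excludes the degenerate case \<open>\<Sigma>(v) = 0\<close>, in which the norm ratio would take its default value 1.\<close>

lemma Psi1_nonzero:
  assumes v: "v \<in> unit_sphere (nparams q)"
  shows "0 < frobenius_norm (Psi1 q v) + \<bar>err_part q v\<bar>"
proof (rule ccontr)
  assume neg: "\<not> ?thesis"
  have 0: "frobenius_norm (Psi1 q v) = 0" and e: "err_part q v = 0"
    using neg frobenius_norm_nonneg[of "Psi1 q v"] abs_ge_zero[of "err_part q v"] by linarith+
  have "vnorm (cov_part q v) = 0"
    using vnorm_vech_frobenius(1)[OF Psi1_spec(1,2), of q v] 0 Psi1_spec(3)[of q v]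
      vnorm_nonneg[of "cov_part q v"] by simp
  then have "cov_part q v = 0\<^sub>v (nparams q - 1)"
    using sprod_self_eq_0[of "cov_part q v" "nparams q - 1"] by (simp add: vnorm_eq_sqrt cov_part_def)
  then have "cov_part q v $ k = 0" if "k < nparams q - 1" for k using that by simp
  then have "v $ k = 0" if "k < nparams q - 1" for k
    using that by (simp add: cov_part_def vec_first_def)
  then have "v $ k = 0" if "k < nparams q" for k
    using that e by (cases "k = nparams q - 1") (auto simp: err_part_def)
  then have "v = 0\<^sub>v (nparams q)" using v by (intro eq_vecI) (auto simp: unit_sphere_def)
  then show False using v by (simp add: unit_sphere_def)
qed

lemma Psi_carrier: "Psi m q v \<in> carrier_mat (m * q) (m * q)"
  unfolding Psi_def by (rule kronecker_one_carrier[OF Psi1_spec(1)])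

lemma Psi_transpose: "(Psi m q v)\<^sup>T = Psi m q v"
proof (rule eq_matI)
  fix i j assume "i < dim_row (Psi m q v)" "j < dim_col (Psi m q v)"
  then have ij: "i < m * q" "j < m * q" using Psi_carrier[of m q v] by auto
  then have q: "q > 0" by (cases q) auto
  show "(Psi m q v)\<^sup>T $$ (i, j) = Psi m q v $$ (i, j)"
    using ij Psi_carrier[of m q v] symmetric_index[OF Psi1_spec(1,2), of "i mod q" q "j mod q" v] q
    by (auto simp: Psi_def kronecker_one_index[OF Psi1_spec(1)])
qed (use Psi_carrier[of m q v] in auto)

lemma Sigma_cov_carrier: "Z \<in> carrier_mat n (m * q) \<Longrightarrow> Sigma_cov m q Z v \<in> carrier_mat n n"
  using Psi_carrier[of m q v] by (auto simp: Sigma_cov_def)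

lemma Sigma_cov_transpose:
  assumes Z: "Z \<in> carrier_mat n (m * q)"
  shows "(Sigma_cov m q Z v)\<^sup>T = Sigma_cov m q Z v"
proof -
  note P = Psi_carrier[of m q v]
  have ZT: "Z\<^sup>T \<in> carrier_mat (m * q) n" using Z by simp
  have "(Z * Psi m q v * Z\<^sup>T)\<^sup>T = Z * (Psi m q v * Z\<^sup>T)"
    using transpose_mult[OF mult_carrier_mat[OF Z P] ZT] transpose_mult[OF Z P]
    by (simp add: Psi_transpose)
  also have "\<dots> = Z * Psi m q v * Z\<^sup>T" using assoc_mult_mat[OF Z P ZT] by simp
  finally have "(Z * Psi m q v * Z\<^sup>T)\<^sup>T = Z * Psi m q v * Z\<^sup>T" .
  moreover have "(err_part q v \<cdot>\<^sub>m 1\<^sub>m n)\<^sup>T = err_part q v \<cdot>\<^sub>m (1\<^sub>m n :: real mat)"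
    by (intro eq_matI) auto
  ultimately show ?thesis
    using Z P transpose_add[of "Z * Psi m q v * Z\<^sup>T" n n "err_part q v \<cdot>\<^sub>m 1\<^sub>m n"]
    by (simp add: Sigma_cov_def)
qed

lemma opnorm_le_Sigma_cov:
  assumes Z: "Z \<in> carrier_mat n (m * q)" "opnorm_le Z (sqrt b)" and q: "q > 0" and b: "0 \<le> b"
  shows "opnorm_le (Sigma_cov m q Z v) (b * frobenius_norm (Psi1 q v) + \<bar>err_part q v\<bar>)"
proof -
  have ZT: "Z\<^sup>T \<in> carrier_mat (m * q) n" using Z by simp
  have "opnorm_le (Psi m q v) (frobenius_norm (Psi1 q v))"
    unfolding Psi_def by (intro opnorm_le_kronecker_one[OF Psi1_spec(1) q] opnorm_le_frobenius[OF Psi1_spec(1)])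
  then have "opnorm_le (Z * Psi m q v * Z\<^sup>T) (sqrt b * frobenius_norm (Psi1 q v) * sqrt b)"
    by (intro opnorm_le_mult[OF mult_carrier_mat[OF Z(1) Psi_carrier] opnorm_le_mult[OF Z(1,2) Psi_carrier] ZT]
      opnorm_le_transpose[OF Z])
  then have "opnorm_le (Z * Psi m q v * Z\<^sup>T) (b * frobenius_norm (Psi1 q v))"
    using b by (simp add: mult.commute mult.left_commute flip: mult.assoc)
  then show ?thesis
    unfolding Sigma_cov_def using Z Psi_carrier[of m q v]
    by (intro opnorm_le_add[of _ n n] opnorm_le_smult_one) auto
qed

text \<open>As \<open>\<Psi>(\<psi>)\<close> is positive semi-definite, the error variance alone bounds \<open>\<Sigma>(\<psi>)\<close> from below.\<close>

lemma Sigma_cov_quadratic_lower: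
  assumes Z: "Z \<in> carrier_mat n (m * q)" and q: "q > 0" and psi: "\<psi> \<in> param_set q"
    and x: "x \<in> carrier_vec n"
  shows "err_part q \<psi> * (x \<bullet> x) \<le> x \<bullet> (Sigma_cov m q Z \<psi> *\<^sub>v x)"
proof -
  note P = Psi_carrier[of m q \<psi>]
  define y where "y = Z\<^sup>T *\<^sub>v x"
  have y: "y \<in> carrier_vec (m * q)" using Z x by (simp add: y_def)
  have pd: "0 \<le> u \<bullet> (Psi1 q \<psi> *\<^sub>v u)" if "u \<in> carrier_vec q" for u
    using psi that Psi1_spec(1)[of q \<psi>] by (auto simp: param_set_def psd_def)
  have "0 \<le> y \<bullet> (Psi m q \<psi> *\<^sub>v y)"
    using y Psi_carrier[of m q \<psi>] Psi1_spec(1)[of q \<psi>] pd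
    unfolding Psi_def kronecker_one_eq_diag_block_mat[OF Psi1_spec(1) q]
    by (intro diag_block_mat_quadratic_nonneg) auto
  then have G: "0 \<le> x \<bullet> ((Z * Psi m q \<psi> * Z\<^sup>T) *\<^sub>v x)"
    unfolding quadratic_form_sandwich[OF Z P x] y_def .
  have car: "Z * Psi m q \<psi> * Z\<^sup>T \<in> carrier_mat n n" using Z P by simp
  have "(err_part q \<psi> \<cdot>\<^sub>m 1\<^sub>m n) *\<^sub>v x = err_part q \<psi> \<cdot>\<^sub>v x" using x by auto
  then have "Sigma_cov m q Z \<psi> *\<^sub>v x = (Z * Psi m q \<psi> * Z\<^sup>T) *\<^sub>v x + err_part q \<psi> \<cdot>\<^sub>v x"
    unfolding Sigma_cov_def using Z x car add_mult_distrib_mat_vec[OF car, of "err_part q \<psi> \<cdot>\<^sub>m 1\<^sub>m n" x]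
    by simp
  then have "x \<bullet> (Sigma_cov m q Z \<psi> *\<^sub>v x)
      = x \<bullet> ((Z * Psi m q \<psi> * Z\<^sup>T) *\<^sub>v x) + err_part q \<psi> * (x \<bullet> x)"
    using x scalar_prod_add_distrib[OF x mult_mat_vec_carrier[OF car x], of "err_part q \<psi> \<cdot>\<^sub>v x"] by simp
  then show ?thesis using G by simp
qed

section \<open>The independent-cluster design\<close>

lemma stack_rows_carrier:
  assumes "cluster_design m ns p q X Z"
  shows "stack_rows p m X \<in> carrier_mat (total_obs m ns) p"
proof -
  have "dim_row (X i) = ns i" if "i < m" for i
    using assms that by (auto simp: cluster_design_def)
  then have "map (\<lambda>i. dim_row (X i)) [0..<m] = map ns [0..<m]" by simp
  then show ?thesis
    by (auto simp: stack_rows_def total_obs_def length_concat comp_def interv_sum_list_conv_sum_set_nat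
      atLeast0LessThan mat_of_rows_def simp del: map_eq_conv)
qed

lemma block_diag_design:
  assumes cd: "cluster_design m ns p q X Z" and rd: "regular_design c1 c2 m ns q Z" and c2: "c2 > 0"
  shows "block_diag m Z \<in> carrier_mat (total_obs m ns) (m * q)"
    and "\<And>y. y \<in> carrier_vec (m * q) \<Longrightarrow> 1 / c2 * (y \<bullet> y) \<le> (block_diag m Z *\<^sub>v y) \<bullet> (block_diag m Z *\<^sub>v y)"
    and "opnorm_le (block_diag m Z) (sqrt c2)"
    and "c1 * real (m * q) \<le> real (total_obs m ns)"
    and "m \<ge> 1" "q \<ge> 1"
proof -
  show mq: "m \<ge> 1" "q \<ge> 1" using cd by (auto simp: cluster_design_def)
  have Zi: "Z i \<in> carrier_mat (ns i) q" if "i < m" for i using cd that by (auto simp: cluster_design_def)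
  have dims: "dim_row (Z i) = ns i" "dim_col (Z i) = q" if "i < m" for i using Zi[OF that] by auto
  have "map (\<lambda>i. dim_row (Z i)) [0..<m] = map ns [0..<m]" "map (\<lambda>i. dim_col (Z i)) [0..<m] = map (\<lambda>_. q) [0..<m]"
    by (auto simp: dims)
  then show car: "block_diag m Z \<in> carrier_mat (total_obs m ns) (m * q)"
    by (auto simp: block_diag_def dim_diag_block_mat total_obs_def comp_def interv_sum_list_conv_sum_set_nat
      atLeast0LessThan sum_list_triv simp del: map_eq_conv)
  have bounds: "1 / c2 * (y \<bullet> y) \<le> (block_diag m Z *\<^sub>v y) \<bullet> (block_diag m Z *\<^sub>v y) \<and>
      (block_diag m Z *\<^sub>v y) \<bullet> (block_diag m Z *\<^sub>v y) \<le> c2 * (y \<bullet> y)" if y: "y \<in> carrier_vec (m * q)" for y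
    unfolding block_diag_def
  proof (rule diag_block_mat_norm_bounds)
    fix A and u :: "real vec" assume "A \<in> set (map Z [0..<m])" and u: "u \<in> carrier_vec (dim_col A)"
    then obtain i where i: "i < m" "A = Z i" by auto
    have A: "A \<in> carrier_mat (ns i) q" using Zi i by simp
    have u': "u \<in> carrier_vec q" using u A by simp
    have AT: "A\<^sup>T \<in> carrier_mat q (ns i)" using A by simp
    have N: "A\<^sup>T * A \<in> carrier_mat q q" "(A\<^sup>T * A)\<^sup>T = A\<^sup>T * A"
      using A transpose_mult[OF AT A] by auto
    have gram: "u \<bullet> ((A\<^sup>T * A) *\<^sub>v u) = (A *\<^sub>v u) \<bullet> (A *\<^sub>v u)"
      using transpose_vec_mult_scalar[OF AT, of "A *\<^sub>v u" u] assoc_mult_mat_vec[OF AT A u'] A u' by simp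
    have eig: "1 / c2 \<le> eig_min (A\<^sup>T * A)" "eig_max (A\<^sup>T * A) \<le> c2"
      using rd i by (auto simp: regular_design_def)
    show "1 / c2 * (u \<bullet> u) \<le> (A *\<^sub>v u) \<bullet> (A *\<^sub>v u) \<and> (A *\<^sub>v u) \<bullet> (A *\<^sub>v u) \<le> c2 * (u \<bullet> u)"
      using rayleigh_bounds[OF N u'] gram mult_right_mono[OF eig(1) sprod_self_nonneg[of u]]
        mult_right_mono[OF eig(2) sprod_self_nonneg[of u]] by linarith
  qed (use y car in \<open>simp add: block_diag_def\<close>)
  then show "1 / c2 * (y \<bullet> y) \<le> (block_diag m Z *\<^sub>v y) \<bullet> (block_diag m Z *\<^sub>v y)" if "y \<in> carrier_vec (m * q)" for y
    using that by blast
  show "opnorm_le (block_diag m Z) (sqrt c2)"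
  proof (rule opnorm_leI[OF _ car])
    fix y :: "real vec" assume "y \<in> carrier_vec (m * q)"
    from bounds[OF this] have "(vnorm (block_diag m Z *\<^sub>v y))\<^sup>2 \<le> (sqrt c2 * vnorm y)\<^sup>2"
      using c2 by (simp add: vnorm_sq power_mult_distrib)
    then show "vnorm (block_diag m Z *\<^sub>v y) \<le> sqrt c2 * vnorm y"
      by (rule power2_le_imp_le) (use c2 in simp)
  qed (use c2 in simp)
  have "c1 \<le> real (total_obs m ns) / real m / real q"
    using rd by (simp add: regular_design_def mean_cluster_size_def)
  then show "c1 * real (m * q) \<le> real (total_obs m ns)"
    using mq by (simp add: field_simps)
qed

text \<open>A matrix whose spectral norm is at most of order \<open>m\<^bsup>-1/2\<^esup>\<close> times its Frobenius norm is flat: no small group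
  of eigenvalues dominates. This is the constant in that relation for \<open>\<Sigma>(v)\<close>.\<close>

definition flatness_const :: "real \<Rightarrow> real \<Rightarrow> real" where
  "flatness_const c1 c2 = c2\<^sup>2 * (1 + 1 / sqrt (c1 - 1)) + 1 / sqrt (c1 - 1)"

lemma flatness_const_pos: "c1 > 1 \<Longrightarrow> c2 > 1 \<Longrightarrow> 0 < flatness_const c1 c2"
  by (auto simp: flatness_const_def intro!: add_pos_pos mult_pos_pos)

text \<open>With \<open>k = m q\<^sub>1\<close>, the assumption on the mean cluster size gives \<open>n - k \<ge> (c\<^sub>1 - 1) k\<close>. So the
  Frobenius norm of \<open>\<Sigma>(v)\<close>, call it \<open>F\<close>, satisfies \<open>\<bar>v\<^sub>r\<bar> sqrt k \<le> F / sqrt (c\<^sub>1 - 1)\<close>. This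
  controls the scalar part twice over: as \<open>k \<ge> m\<close> it bounds \<open>sqrt m \<bar>v\<^sub>r\<bar>\<close>, and it makes the error
  term in \<open>frobenius_sandwich_plus_scalar\<close> a multiple of \<open>F\<close>, which bounds the Frobenius norm of
  \<open>\<Psi>(v)\<close>, that is \<open>sqrt m\<close> times that of \<open>\<Psi>\<^sub>1(v)\<close>. No distinction is needed as to which part of \<open>v\<close>
  is large.\<close>

lemma Sigma_cov_flat:
  assumes cd: "cluster_design m ns p q X Zs" and rd: "regular_design c1 c2 m ns q Zs"
    and c1: "c1 > 1" and c2: "c2 > 1" and v: "v \<in> unit_sphere (nparams q)"
  defines "M \<equiv> Sigma_cov m q (block_diag m Zs) v"
    and "L \<equiv> c2 * frobenius_norm (Psi1 q v) + \<bar>err_part q v\<bar>"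
  shows "sqrt m * L \<le> flatness_const c1 c2 * frobenius_norm M" "0 < L" "0 < frobenius_norm M"
proof -
  have c20: "0 < c2" using c2 by simp
  note D = block_diag_design[OF cd rd c20]
  define Z n k s d where "Z = block_diag m Zs" and "n = total_obs m ns" and "k = m * q"
    and "s = err_part q v" and "d = sqrt (c1 - 1)"
  have d: "0 < d" using c1 by (simp add: d_def)
  have k: "real m \<le> real k" using mult_le_mono2[OF D(6), of m] unfolding k_def of_nat_le_iff by simp
  have nk: "(c1 - 1) * real k \<le> real n - real k" using D(4) by (simp add: n_def k_def algebra_simps)
  moreover have "0 \<le> (c1 - 1) * real k" using c1 by simp
  ultimately have kn: "k \<le> n" by linarith
  have M: "M = Z * Psi m q v * Z\<^sup>T + s \<cdot>\<^sub>m 1\<^sub>m n"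
    using D(1) by (simp add: M_def Sigma_cov_def Z_def s_def n_def)
  have a: "0 < 1 / c2" using c20 by simp
  note F = frobenius_sandwich_plus_scalar[OF D(1)[folded Z_def n_def k_def] kn a
    D(2)[folded Z_def k_def] Psi_carrier[of m q v, folded k_def] M]
  have "\<bar>s\<bar> * (d * sqrt k) \<le> \<bar>s\<bar> * sqrt (real (n - k))"
    unfolding d_def real_sqrt_mult[symmetric] using nk kn
    by (intro mult_left_mono real_sqrt_le_mono) (auto simp: of_nat_diff)
  then have sk: "\<bar>s\<bar> * sqrt k \<le> frobenius_norm M / d" using F(1) d by (simp add: field_simps)
  moreover have "\<bar>s\<bar> * sqrt m \<le> \<bar>s\<bar> * sqrt k" using k by (intro mult_left_mono) auto
  ultimately have sm: "\<bar>s\<bar> * sqrt m \<le> frobenius_norm M / d" by linarith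
  have "frobenius_norm (Psi m q v) = sqrt m * frobenius_norm (Psi1 q v)"
    unfolding Psi_def using D(6) by (intro frobenius_kronecker_one[OF Psi1_spec(1)]) simp
  then have "sqrt m * frobenius_norm (Psi1 q v) / c2 \<le> frobenius_norm M + frobenius_norm M / d"
    using F(2) sk by simp
  then have "c2\<^sup>2 * (sqrt m * frobenius_norm (Psi1 q v) / c2) \<le> c2\<^sup>2 * (frobenius_norm M + frobenius_norm M / d)"
    by (intro mult_left_mono) auto
  then have "sqrt m * (c2 * frobenius_norm (Psi1 q v)) \<le> c2\<^sup>2 * (frobenius_norm M + frobenius_norm M / d)"
    using c20 by (simp add: power2_eq_square)
  then show main: "sqrt m * L \<le> flatness_const c1 c2 * frobenius_norm M"
    using sm unfolding L_def s_def flatness_const_def d_def by (simp add: algebra_simps)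
  show L: "0 < L"
  proof -
    have "1 * frobenius_norm (Psi1 q v) \<le> c2 * frobenius_norm (Psi1 q v)"
      using c2 by (intro mult_right_mono) auto
    then show ?thesis using Psi1_nonzero[OF v] by (simp add: L_def)
  qed
  have "0 < sqrt m * L" using L D(5) by simp
  then have "0 < flatness_const c1 c2 * frobenius_norm M" using main by linarith
  then show "0 < frobenius_norm M" using flatness_const_pos[OF c1 c2] by (simp add: zero_less_mult_iff)
qed

text \<open>The left-hand side bounds the condition number of \<open>\<Sigma>(\<psi>)\<close>.\<close>

lemma Sigma_cov_condition:
  assumes c2: "c2 > 1" and psi: "\<psi> \<in> param_set q"
  shows "(c2 * frobenius_norm (Psi1 q \<psi>) + \<bar>err_part q \<psi>\<bar>) / err_part q \<psi>
    \<le> sqrt 2 * c2 * (1 + vnorm (cov_part q \<psi>) / err_part q \<psi>)"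
proof -
  have e: "0 < err_part q \<psi>" using psi by (simp add: param_set_def)
  have "frobenius_norm (Psi1 q \<psi>) \<le> sqrt 2 * vnorm (cov_part q \<psi>)"
    using vnorm_vech_frobenius(2)[OF Psi1_spec(1,2), of q \<psi>] by (simp add: Psi1_spec(3))
  then have "c2 * frobenius_norm (Psi1 q \<psi>) \<le> c2 * (sqrt 2 * vnorm (cov_part q \<psi>))"
    using c2 by (intro mult_left_mono) auto
  moreover have "1 * 1 \<le> sqrt 2 * c2" using c2 by (intro mult_mono) auto
  then have "1 * err_part q \<psi> \<le> sqrt 2 * c2 * err_part q \<psi>" using e by (intro mult_right_mono) auto
  ultimately have "c2 * frobenius_norm (Psi1 q \<psi>) + \<bar>err_part q \<psi>\<bar>
      \<le> c2 * (sqrt 2 * vnorm (cov_part q \<psi>)) + sqrt 2 * c2 * err_part q \<psi>"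
    using e by linarith
  also have "\<dots> = sqrt 2 * c2 * (err_part q \<psi> + vnorm (cov_part q \<psi>))"
    by (simp add: algebra_simps)
  finally have "c2 * frobenius_norm (Psi1 q \<psi>) + \<bar>err_part q \<psi>\<bar>
      \<le> sqrt 2 * c2 * (err_part q \<psi> + vnorm (cov_part q \<psi>))" .
  then have "(c2 * frobenius_norm (Psi1 q \<psi>) + \<bar>err_part q \<psi>\<bar>) / err_part q \<psi>
      \<le> sqrt 2 * c2 * (err_part q \<psi> + vnorm (cov_part q \<psi>)) / err_part q \<psi>"
    using e by (intro divide_right_mono) auto
  also have "\<dots> = sqrt 2 * c2 * ((err_part q \<psi> + vnorm (cov_part q \<psi>)) / err_part q \<psi>)" by simp
  also have "(err_part q \<psi> + vnorm (cov_part q \<psi>)) / err_part q \<psi>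
      = 1 + vnorm (cov_part q \<psi>) / err_part q \<psi>"
    using e by (simp add: add_divide_distrib)
  finally show ?thesis .
qed

section \<open>The restricted likelihood as a compression\<close>

lemma Psi_entry_cases:
  assumes "k < m * q" "l < m * q"
  shows "(\<forall>w. Psi m q w $$ (k, l) = 0) \<or>
    (\<exists>i<nparams q - 1. \<forall>w. Psi m q w $$ (k, l) = w $ i)"
proof (cases "k div q = l div q")
  case True
  have q: "q > 0" using assms by (cases q) auto
  then obtain i where i: "i < nparams q - 1" "\<And>w. Psi1 q w $$ (k mod q, l mod q) = w $ i"
    using Psi1_coordinate[of "k mod q" q "l mod q"] by auto
  then have "Psi m q w $$ (k, l) = w $ i" for w
    using True by (simp add: Psi_def kronecker_one_index[OF Psi1_spec(1) assms])
  then show ?thesis using i by blast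
next
  case False
  then show ?thesis by (simp add: Psi_def kronecker_one_index[OF Psi1_spec(1) assms])
qed

text \<open>Where an entry of \<open>\<Psi>\<close> is the coordinate \<open>i\<close> of its argument, the partial derivative in coordinate
  \<open>j\<close> is 1 for \<open>j = i\<close> and 0 otherwise. The error variance does not occur in \<open>\<Psi>\<close>, so the sum stops
  before the last coordinate.\<close>

lemma Psi_eq_sum_H_mat:
  assumes psi: "\<psi> \<in> carrier_vec (nparams q)" and kl: "k < m * q" "l < m * q"
  shows "Psi m q v $$ (k, l) = (\<Sum>j<nparams q - 1. v $ j * H_mat m q \<psi> j $$ (k, l))"
  using Psi_entry_cases[OF kl]
proof
  assume 0: "\<forall>w. Psi m q w $$ (k, l) = 0"
  then have "H_mat m q \<psi> j $$ (k, l) = 0" for j using kl by (simp add: H_mat_def)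
  then show ?thesis using 0 by simp
next
  assume "\<exists>i<nparams q - 1. \<forall>w. Psi m q w $$ (k, l) = w $ i"
  then obtain i where i: "i < nparams q - 1" and eq: "\<And>w. Psi m q w $$ (k, l) = w $ i" by blast
  have "H_mat m q \<psi> j $$ (k, l) = (if j = i then 1 else 0)" for j
  proof -
    have "(\<lambda>t. Psi m q (\<psi> + t \<cdot>\<^sub>v unit_vec (nparams q) j) $$ (k, l))
        = (\<lambda>t. \<psi> $ i + t * (if j = i then 1 else 0))"
      unfolding eq using i psi by (auto simp: unit_vec_def)
    moreover have "((\<lambda>t. \<psi> $ i + t * (if j = i then 1 else 0)) has_field_derivative
        (if j = i then 1 else 0)) (at 0)"
      by (auto intro!: derivative_eq_intros)
    ultimately show ?thesis using kl by (simp add: H_mat_def DERIV_imp_deriv)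
  qed
  then have "(\<Sum>j<nparams q - 1. v $ j * H_mat m q \<psi> j $$ (k, l))
      = (\<Sum>j<nparams q - 1. if j = i then v $ j else 0)"
    by (intro sum.cong) auto
  then show ?thesis using i eq by simp
qed

lemma mult_mat_index_sum:
  "A \<in> carrier_mat r k \<Longrightarrow> B \<in> carrier_mat k c \<Longrightarrow> i < r \<Longrightarrow> j < c \<Longrightarrow>
    (A * B) $$ (i, j) = (\<Sum>a<k. A $$ (i, a) * B $$ (a, j) :: real)"
  by (simp add: scalar_prod_def atLeast0LessThan)

lemma sandwich_index:
  assumes A: "A \<in> carrier_mat r k" and B: "B \<in> carrier_mat k k'" and C: "C \<in> carrier_mat k' c"
    and ij: "i < r" "j < c"
  shows "(A * B * C) $$ (i, j) = (\<Sum>b<k'. \<Sum>a<k. A $$ (i, a) * B $$ (a, b) * (C $$ (b, j) :: real))"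
  unfolding mult_mat_index_sum[OF mult_carrier_mat[OF A B] C ij]
  by (intro sum.cong refl) (simp add: mult_mat_index_sum[OF A B ij(1)] sum_distrib_right)

lemma sandwich_linear_combination:
  fixes w :: "'i \<Rightarrow> real"
  assumes A: "A \<in> carrier_mat r k" and C: "C \<in> carrier_mat k' c"
    and P: "P \<in> carrier_mat k k'" and H: "\<And>j. j \<in> J \<Longrightarrow> H j \<in> carrier_mat k k'"
    and eq: "\<And>a b. a < k \<Longrightarrow> b < k' \<Longrightarrow> P $$ (a, b) = (\<Sum>j\<in>J. w j * H j $$ (a, b))"
    and ij: "i < r" "l < c"
  shows "(\<Sum>j\<in>J. w j * (A * H j * C) $$ (i, l)) = (A * P * C) $$ (i, l)"
proof -
  have "(A * P * C) $$ (i, l) = (\<Sum>b<k'. \<Sum>a<k. \<Sum>j\<in>J. w j * (A $$ (i, a) * H j $$ (a, b) * C $$ (b, l)))"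
    unfolding sandwich_index[OF A P C ij]
    by (intro sum.cong) (auto simp: eq sum_distrib_left sum_distrib_right ac_simps)
  also have "\<dots> = (\<Sum>b<k'. \<Sum>j\<in>J. \<Sum>a<k. w j * (A $$ (i, a) * H j $$ (a, b) * C $$ (b, l)))"
    by (intro sum.cong refl sum.swap)
  also have "\<dots> = (\<Sum>j\<in>J. \<Sum>b<k'. \<Sum>a<k. w j * (A $$ (i, a) * H j $$ (a, b) * C $$ (b, l)))"
    by (rule sum.swap)
  also have "\<dots> = (\<Sum>j\<in>J. w j * (A * H j * C) $$ (i, l))"
    by (intro sum.cong) (auto simp: sandwich_index[OF A H C ij] sum_distrib_left)
  finally show ?thesis by simp
qed

lemma Sigma_tilde_eq:
  assumes Z: "Z \<in> carrier_mat n (m * q)" and V: "V \<in> carrier_mat n k" "V\<^sup>T * V = 1\<^sub>m k"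
  shows "Sigma_tilde m q Z V v
    = (V\<^sup>T * Z) * Psi m q v * (V\<^sup>T * Z)\<^sup>T + err_part q v \<cdot>\<^sub>m 1\<^sub>m k"
proof -
  note P = Psi_carrier[of m q v]
  have VT: "V\<^sup>T \<in> carrier_mat k n" and ZT: "Z\<^sup>T \<in> carrier_mat (m * q) n" using V Z by auto
  define G where "G = Z * Psi m q v * Z\<^sup>T"
  have G: "G \<in> carrier_mat n n" using Z P by (simp add: G_def)
  have "V\<^sup>T * Sigma_cov m q Z v = V\<^sup>T * G + err_part q v \<cdot>\<^sub>m V\<^sup>T"
    unfolding Sigma_cov_def G_def[symmetric] using Z G VT
    by (simp add: mult_add_distrib_mat[OF VT G] mult_smult_distrib[OF VT one_carrier_mat])
  then have "Sigma_tilde m q Z V v = V\<^sup>T * G * V + err_part q v \<cdot>\<^sub>m (V\<^sup>T * V)"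
    unfolding Sigma_tilde_def using V(1) G VT
    by (simp add: add_mult_distrib_mat[of _ k n _ _ k] mult_smult_assoc_mat[OF VT V(1)])
  moreover have "V\<^sup>T * G * V = (V\<^sup>T * Z) * Psi m q v * (V\<^sup>T * Z)\<^sup>T"
  proof -
    have "(V\<^sup>T * Z)\<^sup>T = Z\<^sup>T * V" using transpose_mult[OF VT Z] by simp
    moreover have "V\<^sup>T * G = V\<^sup>T * Z * (Psi m q v * Z\<^sup>T)"
      unfolding G_def using assoc_mult_mat[OF Z P ZT] assoc_mult_mat[OF VT Z, of "Psi m q v * Z\<^sup>T" n] P ZT by simp
    moreover have "V\<^sup>T * Z * (Psi m q v * Z\<^sup>T) = V\<^sup>T * Z * Psi m q v * Z\<^sup>T"
      using assoc_mult_mat[OF mult_carrier_mat[OF VT Z] P ZT] by simp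
    ultimately show ?thesis
      using assoc_mult_mat[OF mult_carrier_mat[OF mult_carrier_mat[OF VT Z] P] ZT V(1)] by simp
  qed
  ultimately show ?thesis using V(2) by simp
qed

text \<open>Identifies the sum over coordinates with the whitening of the compression \<open>V\<^sup>T \<Sigma>(v) V\<close>, the form to
  which \<open>norm_ratio_whitened_le\<close> applies. The last coordinate contributes \<open>v\<^sub>r\<close> times the inverse of
  \<open>V\<^sup>T \<Sigma>(\<psi>) V\<close>, which is the whitened identity matrix.\<close>

lemma A_tilde_eq:
  assumes Z: "Z \<in> carrier_mat n (m * q)" and V: "V \<in> carrier_mat n k" "V\<^sup>T * V = 1\<^sub>m k"
    and psi: "\<psi> \<in> carrier_vec (nparams q)"
    and R: "inv_sqrt (Sigma_tilde m q Z V \<psi>) \<in> carrier_mat k k"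
      "inv_sqrt (Sigma_tilde m q Z V \<psi>) * inv_sqrt (Sigma_tilde m q Z V \<psi>)
        = inv_mat (Sigma_tilde m q Z V \<psi>)"
  shows "A_tilde m q Z V v \<psi> = inv_sqrt (Sigma_tilde m q Z V \<psi>) * Sigma_tilde m q Z V v
    * inv_sqrt (Sigma_tilde m q Z V \<psi>)"
proof -
  define S R Zt where "S = Sigma_tilde m q Z V \<psi>" and "R = inv_sqrt S" and "Zt = V\<^sup>T * Z"
  have Rc: "R \<in> carrier_mat k k" and RR: "R * R = inv_mat S" using R by (auto simp: R_def S_def)
  have Zt: "Zt \<in> carrier_mat k (m * q)" using Z V by (simp add: Zt_def)
  have ZtT: "Zt\<^sup>T \<in> carrier_mat (m * q) k" using Zt by simp
  note P = Psi_carrier[of m q v]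
  have H: "H_mat m q \<psi> j \<in> carrier_mat (m * q) (m * q)" for j by (simp add: H_mat_def)
  define e where "e = err_part q v"
  have split: "R * Zt * B * Zt\<^sup>T * R = (R * Zt) * B * (Zt\<^sup>T * R)" if "B \<in> carrier_mat (m * q) (m * q)" for B
    using assoc_mult_mat[OF mult_carrier_mat[OF mult_carrier_mat[OF Rc Zt] that] ZtT Rc] .
  have "R * Sigma_tilde m q Z V v = R * (Zt * Psi m q v * Zt\<^sup>T) + e \<cdot>\<^sub>m R"
    unfolding Sigma_tilde_eq[OF Z V] Zt_def[symmetric] e_def[symmetric] using Rc Zt P
    by (simp add: mult_add_distrib_mat[of _ k k _ k] mult_smult_distrib[OF Rc one_carrier_mat])
  also have "R * (Zt * Psi m q v * Zt\<^sup>T) = R * Zt * Psi m q v * Zt\<^sup>T"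
    using assoc_mult_mat[OF Rc mult_carrier_mat[OF Zt P] ZtT] assoc_mult_mat[OF Rc Zt P] by simp
  finally have "R * Sigma_tilde m q Z V v * R = (R * Zt * Psi m q v * Zt\<^sup>T + e \<cdot>\<^sub>m R) * R"
    by (rule arg_cong)
  also have "\<dots> = R * Zt * Psi m q v * Zt\<^sup>T * R + e \<cdot>\<^sub>m R * R"
    by (intro add_mult_distrib_mat[of _ k k _ _ k] mult_carrier_mat[OF mult_carrier_mat[OF mult_carrier_mat[OF Rc Zt] P] ZtT]
      smult_carrier_mat Rc)
  also have "e \<cdot>\<^sub>m R * R = e \<cdot>\<^sub>m (R * R)" by (rule mult_smult_assoc_mat[OF Rc Rc])
  finally have "R * Sigma_tilde m q Z V v * R = R * Zt * Psi m q v * Zt\<^sup>T * R + e \<cdot>\<^sub>m (R * R)" .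
  then have rhs: "R * Sigma_tilde m q Z V v * R
      = (R * Zt) * Psi m q v * (Zt\<^sup>T * R) + e \<cdot>\<^sub>m inv_mat S"
    unfolding split[OF P] RR .
  have "A_tilde m q Z V v \<psi> = R * Sigma_tilde m q Z V v * R"
    unfolding rhs
  proof (rule eq_matI)
    have iS: "inv_mat S \<in> carrier_mat k k" using mult_carrier_mat[OF Rc Rc] unfolding RR .
    show "dim_row (A_tilde m q Z V v \<psi>) = dim_row ((R * Zt) * Psi m q v * (Zt\<^sup>T * R) + e \<cdot>\<^sub>m inv_mat S)"
      "dim_col (A_tilde m q Z V v \<psi>) = dim_col ((R * Zt) * Psi m q v * (Zt\<^sup>T * R) + e \<cdot>\<^sub>m inv_mat S)"
      using iS V by (auto simp: A_tilde_def)
    fix i l assume "i < dim_row ((R * Zt) * Psi m q v * (Zt\<^sup>T * R) + e \<cdot>\<^sub>m inv_mat S)"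
      "l < dim_col ((R * Zt) * Psi m q v * (Zt\<^sup>T * R) + e \<cdot>\<^sub>m inv_mat S)"
    then have il: "i < k" "l < k" using iS by auto
    have np: "nparams q = Suc (nparams q - 1)" by (simp add: nparams_def)
    have coord: "A_tilde_coord m q Z V \<psi> j
        = (if j < nparams q - 1 then (R * Zt) * H_mat m q \<psi> j * (Zt\<^sup>T * R) else inv_mat S)" for j
      unfolding A_tilde_coord_def Let_def S_def[symmetric] R_def[symmetric] Zt_def[symmetric]
      using split[OF H] by simp
    have "A_tilde m q Z V v \<psi> $$ (i, l) = (\<Sum>j<nparams q. v $ j * A_tilde_coord m q Z V \<psi> j $$ (i, l))"
      using il V by (simp add: A_tilde_def)
    also have "\<dots> = (\<Sum>j<nparams q - 1. v $ j * ((R * Zt) * H_mat m q \<psi> j * (Zt\<^sup>T * R)) $$ (i, l))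
        + e * inv_mat S $$ (i, l)"
      by (subst np, subst sum.lessThan_Suc) (simp add: coord e_def err_part_def)
    also have "(\<Sum>j<nparams q - 1. v $ j * ((R * Zt) * H_mat m q \<psi> j * (Zt\<^sup>T * R)) $$ (i, l))
        = ((R * Zt) * Psi m q v * (Zt\<^sup>T * R)) $$ (i, l)"
      using sandwich_linear_combination[OF mult_carrier_mat[OF Rc Zt] mult_carrier_mat[OF ZtT Rc] P H
        Psi_eq_sum_H_mat[OF psi] il] by simp
    finally show "A_tilde m q Z V v \<psi> $$ (i, l)
        = ((R * Zt) * Psi m q v * (Zt\<^sup>T * R) + e \<cdot>\<^sub>m inv_mat S) $$ (i, l)"
      using il iS Rc Zt P by simp
  qed
  then show ?thesis by (simp add: R_def S_def)
qed

section \<open>Bounds on the norm ratios\<close>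

lemma powr_minus_half: "real m powr (- 1 / 2) = 1 / sqrt (real m)"
  using powr_minus_divide[of "real m" "1 / 2"] by (simp add: powr_half_sqrt)

lemma a_ratio_bound:
  assumes cd: "cluster_design m ns p q X Z" and rd: "regular_design c1 c2 m ns q Z"
    and c1: "c1 > 1" and c2: "c2 > 1" and v: "v \<in> unit_sphere (nparams q)" and psi: "\<psi> \<in> param_set q"
  shows "a_ratio m q (block_diag m Z) v \<psi>
    \<le> (sqrt 2 * c2 * flatness_const c1 c2) * real m powr (- 1 / 2)
      * (1 + vnorm (cov_part q \<psi>) / err_part q \<psi>)"
proof -
  have c20: "0 < c2" using c2 by simp
  note D = block_diag_design[OF cd rd c20]
  have q: "q > 0" using D(6) by simp
  have e: "0 < err_part q \<psi>" using psi by (simp add: param_set_def)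
  define C where "C = flatness_const c1 c2 / sqrt m"
  have C0: "0 \<le> C" using flatness_const_pos[OF c1 c2] by (simp add: C_def)
  note F = Sigma_cov_flat[OF cd rd c1 c2 v]
  note S = Sigma_cov_carrier[OF D(1)]
  note lo = Sigma_cov_quadratic_lower[OF D(1) q psi]
  note op = opnorm_le_Sigma_cov[OF D(1,3) q less_imp_le[OF c20]]
  have LC: "c2 * frobenius_norm (Psi1 q v) + \<bar>err_part q v\<bar>
      \<le> C * frobenius_norm (Sigma_cov m q (block_diag m Z) v)"
    using F(1) D(5) by (simp add: C_def pos_le_divide_eq mult.commute)
  have "psd (Sigma_cov m q (block_diag m Z) \<psi>)"
    using S lo e Sigma_cov_transpose[OF D(1)] by (rule psd_if_quadratic_lower)
  then have "a_ratio m q (block_diag m Z) v \<psi>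
    \<le> (c2 * frobenius_norm (Psi1 q \<psi>) + \<bar>err_part q \<psi>\<bar>) / err_part q \<psi> * C"
    unfolding a_ratio_def A_mat_def
    by (rule norm_ratio_whitened_le[OF S _ lo e op S op F(3)])
      (assumption | rule LC)+
  also have "\<dots> \<le> sqrt 2 * c2 * (1 + vnorm (cov_part q \<psi>) / err_part q \<psi>) * C"
    by (rule mult_right_mono[OF Sigma_cov_condition[OF c2 psi] C0])
  also have "C = flatness_const c1 c2 * real m powr (- 1 / 2)"
    unfolding C_def powr_minus_half by simp
  finally show ?thesis by (simp add: ac_simps)
qed

text \<open>Write \<open>K\<close> for the flatness constant of \<open>\<Sigma>(v)\<close> and \<open>L\<close> for the bound on its spectral norm. The
  compression loses at most \<open>2 sqrt p L\<close> of the Frobenius norm of \<open>\<Sigma>(v)\<close>. Under the assumption on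
  \<open>p / m\<close> this is at most half of the lower bound \<open>sqrt m L / K\<close> for that norm, so \<open>V\<^sup>T \<Sigma>(v) V\<close> is
  flat as well, with constant \<open>2 K\<close>.\<close>

lemma a_tilde_ratio_bound:
  assumes cd: "cluster_design m ns p q X Z" and rd: "regular_design c1 c2 m ns q Z"
    and c1: "c1 > 1" and c2: "c2 > 1" and v: "v \<in> unit_sphere (nparams q)" and psi: "\<psi> \<in> param_set q"
    and V: "V \<in> carrier_mat (total_obs m ns) (total_obs m ns - p)"
      "V\<^sup>T * V = 1\<^sub>m (total_obs m ns - p)"
    and p: "p < total_obs m ns" and pm: "real p / real m \<le> 1 / (4 * flatness_const c1 c2)\<^sup>2"
  shows "a_tilde_ratio m q (block_diag m Z) V v \<psi>
    \<le> (2 * sqrt 2 * c2 * flatness_const c1 c2) * real m powr (- 1 / 2)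
      * (1 + vnorm (cov_part q \<psi>) / err_part q \<psi>)"
proof -
  have c20: "0 < c2" using c2 by simp
  note D = block_diag_design[OF cd rd c20]
  have q: "q > 0" using D(6) by simp
  have e: "0 < err_part q \<psi>" using psi by (simp add: param_set_def)
  define K where "K = flatness_const c1 c2"
  have K: "0 < K" using flatness_const_pos[OF c1 c2] by (simp add: K_def)
  note F = Sigma_cov_flat[OF cd rd c1 c2 v, folded K_def]
  define n k where "n = total_obs m ns" and "k = total_obs m ns - p"
  have Z: "block_diag m Z \<in> carrier_mat n (m * q)" using D(1) by (simp add: n_def)
  have V: "V \<in> carrier_mat n k" "V\<^sup>T * V = 1\<^sub>m k" using V by (auto simp: n_def k_def)
  have VT: "V\<^sup>T \<in> carrier_mat k n" using V by simp
  have kn: "k \<le> n" "n - k = p" using p by (auto simp: n_def k_def)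
  note S = Sigma_cov_carrier[OF Z]
  note op = opnorm_le_Sigma_cov[OF Z D(3) q less_imp_le[OF c20]]
  have Vop: "opnorm_le V 1" by (rule opnorm_le_isometry[OF V])
  have St: "Sigma_tilde m q (block_diag m Z) V w \<in> carrier_mat k k" for w
    using mult_carrier_mat[OF mult_carrier_mat[OF VT S] V(1)] by (simp add: Sigma_tilde_def)
  have op_tilde: "opnorm_le (Sigma_tilde m q (block_diag m Z) V w)
      (c2 * frobenius_norm (Psi1 q w) + \<bar>err_part q w\<bar>)" for w
    using opnorm_le_mult[OF mult_carrier_mat[OF VT S] opnorm_le_mult[OF VT opnorm_le_transpose[OF V(1) Vop] S op] V(1) Vop]
    by (simp add: Sigma_tilde_def)
  have lo: "err_part q \<psi> * (x \<bullet> x) \<le> x \<bullet> (Sigma_tilde m q (block_diag m Z) V \<psi> *\<^sub>v x)"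
    if x: "x \<in> carrier_vec k" for x
  proof -
    have Vx: "V *\<^sub>v x \<in> carrier_vec n" using V x by simp
    have "x \<bullet> x = (V *\<^sub>v x) \<bullet> (V *\<^sub>v x)" using isometry_sprod[OF V x] by simp
    moreover have "x \<bullet> (Sigma_tilde m q (block_diag m Z) V \<psi> *\<^sub>v x)
        = (V *\<^sub>v x) \<bullet> (Sigma_cov m q (block_diag m Z) \<psi> *\<^sub>v (V *\<^sub>v x))"
      using quadratic_form_sandwich[OF VT S x] by (simp add: Sigma_tilde_def)
    ultimately show ?thesis using Sigma_cov_quadratic_lower[OF Z q psi Vx] by simp
  qed
  have sym: "(Sigma_tilde m q (block_diag m Z) V \<psi>)\<^sup>T = Sigma_tilde m q (block_diag m Z) V \<psi>"
    unfolding Sigma_tilde_def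
    using transpose_mult[OF mult_carrier_mat[OF VT S] V(1)] transpose_mult[OF VT S]
      Sigma_cov_transpose[OF Z] assoc_mult_mat[OF VT S V(1)] by simp
  have psd: "psd (Sigma_tilde m q (block_diag m Z) V \<psi>)"
    by (rule psd_if_quadratic_lower[OF St lo e sym])
  define L T M where "L = c2 * frobenius_norm (Psi1 q v) + \<bar>err_part q v\<bar>"
    and "T = Sigma_tilde m q (block_diag m Z) V v" and "M = Sigma_cov m q (block_diag m Z) v"
  have flat: "sqrt m * L \<le> K * frobenius_norm M" using F(1) by (simp add: L_def M_def)
  have L: "0 < L" using F(2) by (simp add: L_def)
  have m: "0 < sqrt m" using D(5) by simp
  have "frobenius_norm M \<le> frobenius_norm T + 2 * sqrt p * L"
    using frobenius_compression[OF V kn(1) S op, of v] by (simp add: T_def M_def L_def Sigma_tilde_def kn)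
  then have "K * frobenius_norm M \<le> K * frobenius_norm T + 2 * (K * sqrt p) * L"
    using K mult_left_mono[of "frobenius_norm M" "frobenius_norm T + 2 * sqrt p * L" K]
    by (simp add: algebra_simps)
  \<comment> \<open>The factor \<open>4\<close> in the assumption on \<open>p / m\<close> makes the lost part \<open>2 * sqrt p * L\<close> at most half of \<open>sqrt m * L / K\<close>.\<close>
  moreover have "4 * K * sqrt p \<le> sqrt m"
  proof (rule power2_le_imp_le)
    show "(4 * K * sqrt p)\<^sup>2 \<le> (sqrt m)\<^sup>2"
      using pm K D(5) by (simp add: power_mult_distrib K_def[symmetric] field_simps)
  qed simp
  then have "2 * (K * sqrt p) * L \<le> sqrt m * L / 2" using L by simp
  ultimately have TL: "sqrt m * L \<le> 2 * K * frobenius_norm T" using flat by simp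
  then have "0 < 2 * K * frobenius_norm T" using mult_pos_pos[OF m L] by linarith
  then have T0: "0 < frobenius_norm T" using K by (simp add: zero_less_mult_iff)
  define C where "C = 2 * K / sqrt m"
  have C0: "0 \<le> C" using K by (simp add: C_def)
  have R: "inv_sqrt (Sigma_tilde m q (block_diag m Z) V \<psi>) \<in> carrier_mat k k"
    "inv_sqrt (Sigma_tilde m q (block_diag m Z) V \<psi>) * inv_sqrt (Sigma_tilde m q (block_diag m Z) V \<psi>)
      = inv_mat (Sigma_tilde m q (block_diag m Z) V \<psi>)"
    by (rule inv_sqrt_posdef(1)[OF St psd lo e], assumption) (rule inv_sqrt_posdef(4)[OF St psd lo e], assumption)
  have psic: "\<psi> \<in> carrier_vec (nparams q)" using psi by (simp add: param_set_def)
  have "L \<le> C * frobenius_norm T" using TL m by (simp add: C_def field_simps)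
  then have "a_tilde_ratio m q (block_diag m Z) V v \<psi>
    \<le> (c2 * frobenius_norm (Psi1 q \<psi>) + \<bar>err_part q \<psi>\<bar>) / err_part q \<psi> * C"
    unfolding a_tilde_ratio_def A_tilde_eq[OF Z V psic R] T_def[symmetric]
    using norm_ratio_whitened_le[OF St psd lo e op_tilde St op_tilde[of v], folded L_def T_def] T0 by simp
  also have "\<dots> \<le> sqrt 2 * c2 * (1 + vnorm (cov_part q \<psi>) / err_part q \<psi>) * C"
    by (rule mult_right_mono[OF Sigma_cov_condition[OF c2 psi] C0])
  also have "C = 2 * flatness_const c1 c2 * real m powr (- 1 / 2)"
    unfolding C_def K_def powr_minus_half by simp
  finally show ?thesis by (simp add: ac_simps)
qed

theorem theorem3:
  fixes c1 c2 :: real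
  assumes "c1 > 1" and "c2 > 1"
  shows
    "(\<exists>c3::real. \<forall>m ns p q1 X Z.
        cluster_design m ns p q1 X Z \<and> regular_design c1 c2 m ns q1 Z \<longrightarrow>
        (\<forall>v \<in> unit_sphere (nparams q1). \<forall>\<psi> \<in> param_set q1.
           a_ratio m q1 (block_diag m Z) v \<psi>
             \<le> c3 * real m powr (- 1 / 2) * (1 + vnorm (cov_part q1 \<psi>) / err_part q1 \<psi>)))
     \<and>
     (\<exists>c4::real. c4 > 0 \<and> (\<exists>c3::real. \<forall>m ns p q1 X Z V.
        cluster_design m ns p q1 X Z \<and> regular_design c1 c2 m ns q1 Z \<and>
        full_column_rank (stack_rows p m X) \<and> p < total_obs m ns \<and>
        real p / real m \<le> c4 \<and>
        complement_basis (stack_rows p m X) V \<longrightarrow>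
        (\<forall>v \<in> unit_sphere (nparams q1). \<forall>\<psi> \<in> param_set q1.
           a_tilde_ratio m q1 (block_diag m Z) V v \<psi>
             \<le> c3 * real m powr (- 1 / 2) * (1 + vnorm (cov_part q1 \<psi>) / err_part q1 \<psi>))))"
proof (intro conjI exI allI impI ballI; (elim conjE)?)
  show "0 < 1 / (4 * flatness_const c1 c2)\<^sup>2" using flatness_const_pos[OF assms] by simp
next
  fix m ns p q1 X Z v \<psi>
  assume "cluster_design m ns p q1 X Z" "regular_design c1 c2 m ns q1 Z"
    "v \<in> unit_sphere (nparams q1)" "\<psi> \<in> param_set q1"
  then show "a_ratio m q1 (block_diag m Z) v \<psi>
    \<le> (sqrt 2 * c2 * flatness_const c1 c2) * real m powr (- 1 / 2)
      * (1 + vnorm (cov_part q1 \<psi>) / err_part q1 \<psi>)"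
    by (intro a_ratio_bound[OF _ _ assms])
next
  fix m ns p q1 X Z V v \<psi>
  assume cd: "cluster_design m ns p q1 X Z" and "regular_design c1 c2 m ns q1 Z"
    "p < total_obs m ns" "real p / real m \<le> 1 / (4 * flatness_const c1 c2)\<^sup>2"
    and cb: "complement_basis (stack_rows p m X) V"
    and "v \<in> unit_sphere (nparams q1)" "\<psi> \<in> param_set q1"
  moreover have "V \<in> carrier_mat (total_obs m ns) (total_obs m ns - p)"
      "V\<^sup>T * V = 1\<^sub>m (total_obs m ns - p)"
    using cb stack_rows_carrier[OF cd] by (auto simp: complement_basis_def)
  ultimately show "a_tilde_ratio m q1 (block_diag m Z) V v \<psi>
    \<le> (2 * sqrt 2 * c2 * flatness_const c1 c2) * real m powr (- 1 / 2)
      * (1 + vnorm (cov_part q1 \<psi>) / err_part q1 \<psi>)"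
    by (intro a_tilde_ratio_bound[OF _ _ assms])
qed

end
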